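(* Let $X$ and $Z$ be Banach spaces. Let $\alpha$ be a tensor norm and let $\mathcal{A}$ be the dual space operator ideal of $\alpha$. The following statements are equivalent. (a) For every Banach space $Y$ and for every operator $S\in\mathcal{L}(Z,\mathcal{L}(X,Y))$, there exists $U\in\mathcal{L}(Z\hat{\otimes}_{\alpha}X,Y)$ such that $U^{\#}=S$. (b) There exists a Banach space $Y\neq\{0\}$ such that for every operator $S\in\mathcal{L}(Z,\mathcal{L}(X,Y))$, there exists $U\in\mathcal{L}(Z\hat{\otimes}_{\alpha}X,Y)$ such that $U^{\#}=S$. (c) $\mathcal{L}(Z,X^{*})=\mathcal{A}(Z,X^{*})$ as sets. (d) The tensor norms $\alpha$ and $\pi$ are equivalent on $Z\otimes X$.
   Context: All Banach spaces are over the same field $\mathbb{K}$ ($\mathbb{R}$ or $\mathbb{C}$); $\mathcal{L}(X,Y)$ is the Banach space of bounded linear operators from $X$ to $Y$ with the operator norm. A tensor norm is a finitely generated uniform crossnorm in the sense of Grothendieck (as in Ryan's book): it assigns to each pair of Banach spaces $Z,X$ a norm $\alpha$ on $Z\otimes X$ with $\varepsilon\le\alpha\le\pi$ ($\varepsilon$ the injective and $\pi$ the projective tensor norm), with $\|A\otimes B\|\le\|A\|\,\|B\|$ for bounded operators $A,B$ with respect to $\alpha$, and with $\alpha$ on $Z\otimes X$ determined by its values on $M\otimes N$ for finite-dimensional subspaces $M\subset Z$, $N\subset X$ (as an infimum). $Z\otimes_\alpha X$ is $Z\otimes X$ with norm $\alpha$ and $Z\hat{\otimes}_{\alpha}X$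 is its completion. For $U\in\mathcal{L}(Z\hat{\otimes}_{\alpha}X,Y)$, the associated operator $U^{\#}\in\mathcal{L}(Z,\mathcal{L}(X,Y))$ is defined by $(U^{\#}z)x=U(z\otimes x)$, $z\in Z$, $x\in X$. The dual space operator ideal $\mathcal{A}$ of $\alpha$ is the Banach operator ideal of $\alpha'$-integral operators ($\alpha'$ the dual tensor norm), for which canonically $(Z\hat{\otimes}_{\alpha}X)^{*}=\mathcal{A}(Z,X^{*})$ as Banach spaces under the duality $\langle A,\sum_{i=1}^n z_i\otimes x_i\rangle=\sum_{i=1}^n (Az_i)(x_i)$; that is, $\mathcal{A}(Z,X^* )$ consists exactly of those $A\in\mathcal{L}(Z,X^* )$ for which this linear functional on $Z\otimes X$ is $\alpha$-bounded, and $\|A\|_{\mathcal{A}}$ is the norm of this functional. *)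

theory Defs
  imports "HOL-Analysis.Analysis" "HOL-Algebra.Module"
begin

section \<open>Normed spaces over the real or complex field\<close>

text \<open>
  The scalar field is a set \<^term>\<open>K :: complex set\<close> that is either \<^term>\<open>\<real> :: complex set\<close> or
  \<^term>\<open>UNIV :: complex set\<close>. Spaces are carrier-based modules over it, so that one can quantify
  over Banach spaces inside a formula. The fields \<^const>\<open>mult\<close> and \<^const>\<open>one\<close>, which
  \<^theory>\<open>HOL-Algebra.Module\<close> inherits from rings, play no role.
\<close>

record 'b nspace = "(complex, 'b) module" +
  nrm :: "'b \<Rightarrow> real"

definition scalar_ring :: "complex set \<Rightarrow> complex ring"
  where "scalar_ring K = \<lparr>carrier = K, mult = (*), one = 1, zero = 0, add = (+)\<rparr>"

definition scalar_space :: "complex set \<Rightarrow> complex nspace"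
  where "scalar_space K =
    \<lparr>carrier = K, mult = (*), one = 1, zero = 0, add = (+), smult = (*), nrm = cmod\<rparr>"

locale normed_space = module "scalar_ring K" V
  for K :: "complex set" and V :: "'b nspace" (structure) +
  assumes scalar_field: "K = \<real> \<or> K = UNIV"
    and nrm_nonneg: "x \<in> carrier V \<Longrightarrow> 0 \<le> nrm V x"
    and nrm_eq_zero_iff: "x \<in> carrier V \<Longrightarrow> nrm V x = 0 \<longleftrightarrow> x = \<zero>"
    and nrm_triangle: "x \<in> carrier V \<Longrightarrow> y \<in> carrier V \<Longrightarrow> nrm V (x \<oplus> y) \<le> nrm V x + nrm V y"
    and nrm_smult: "c \<in> K \<Longrightarrow> x \<in> carrier V \<Longrightarrow> nrm V (c \<odot>\<^bsub>V\<^esub> x) = cmod c * nrm V x"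

text \<open>
  The locale \<^locale>\<open>Metric_space\<close> demands symmetry and nonnegativity of the distance also outside
  of the carrier, whence the cut-off.
\<close>

definition ndist :: "'b nspace \<Rightarrow> 'b \<Rightarrow> 'b \<Rightarrow> real"
  where "ndist V x y =
    (if x \<in> carrier V \<and> y \<in> carrier V then nrm V (x \<ominus>\<^bsub>V\<^esub> y) else 0)"

locale banach_space = normed_space +
  assumes complete: "Metric_space.mcomplete (carrier V) (ndist V)"

definition finite_dim_subspace :: "complex set \<Rightarrow> 'b nspace \<Rightarrow> 'b set \<Rightarrow> bool"
  where "finite_dim_subspace K V M \<longleftrightarrow>
    submodule M (scalar_ring K) V \<and>
    (\<exists>F. finite F \<and> F \<subseteq> M \<and>
      (\<forall>N. submodule N (scalar_ring K) V \<and> F \<subseteq> N \<longrightarrow> M \<subseteq> N))"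


section \<open>Bounded linear operators\<close>

definition linear_op :: "complex set \<Rightarrow> 'a nspace \<Rightarrow> 'b nspace \<Rightarrow> ('a \<Rightarrow> 'b) \<Rightarrow> bool"
  where "linear_op K V W f \<longleftrightarrow>
    f \<in> carrier V \<rightarrow> carrier W \<and>
    (\<forall>x\<in>carrier V. \<forall>y\<in>carrier V. f (x \<oplus>\<^bsub>V\<^esub> y) = f x \<oplus>\<^bsub>W\<^esub> f y) \<and>
    (\<forall>c\<in>K. \<forall>x\<in>carrier V. f (c \<odot>\<^bsub>V\<^esub> x) = c \<odot>\<^bsub>W\<^esub> f x)"

definition op_norm :: "'a nspace \<Rightarrow> 'b nspace \<Rightarrow> ('a \<Rightarrow> 'b) \<Rightarrow> real"
  where "op_norm V W f = Sup {nrm W (f x) | x. x \<in> carrier V \<and> nrm V x \<le> 1}"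

text \<open>
  Elements of the operator space are made extensional (\<^const>\<open>undefined\<close> off the carrier), so
  that equality of functions is equality of operators.
\<close>

definition op_space :: "complex set \<Rightarrow> 'a nspace \<Rightarrow> 'b nspace \<Rightarrow> ('a \<Rightarrow> 'b) nspace"
  where "op_space K V W =
    \<lparr>carrier = {f \<in> extensional (carrier V). linear_op K V W f \<and>
        (\<exists>C. \<forall>x\<in>carrier V. nrm W (f x) \<le> C * nrm V x)},
     mult = undefined, one = undefined,
     zero = (\<lambda>x\<in>carrier V. \<zero>\<^bsub>W\<^esub>),
     add = (\<lambda>f g. \<lambda>x\<in>carrier V. f x \<oplus>\<^bsub>W\<^esub> g x),
     smult = (\<lambda>c f. \<lambda>x\<in>carrier V. c \<odot>\<^bsub>W\<^esub> f x),
     nrm = op_norm V W\<rparr>"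

abbreviation ops :: "complex set \<Rightarrow> 'a nspace \<Rightarrow> 'b nspace \<Rightarrow> ('a \<Rightarrow> 'b) set"
  where "ops K V W \<equiv> carrier (op_space K V W)"

definition dual_space :: "complex set \<Rightarrow> 'a nspace \<Rightarrow> ('a \<Rightarrow> complex) nspace"
  where "dual_space K V = op_space K V (scalar_space K)"


section \<open>Completion\<close>

text \<open>Cauchy sequences modulo null sequences.\<close>

definition cauchy_rel :: "'b nspace \<Rightarrow> ((nat \<Rightarrow> 'b) \<times> (nat \<Rightarrow> 'b)) set"
  where "cauchy_rel V =
    {(s, t). Metric_space.MCauchy (carrier V) (ndist V) s \<and>
             Metric_space.MCauchy (carrier V) (ndist V) t \<and>
             (\<lambda>n. ndist V (s n) (t n)) \<longlonglongrightarrow> 0}"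

definition completion :: "'b nspace \<Rightarrow> (nat \<Rightarrow> 'b) set nspace"
  where "completion V =
    \<lparr>carrier = {s. Metric_space.MCauchy (carrier V) (ndist V) s} // cauchy_rel V,
     mult = undefined, one = undefined,
     zero = cauchy_rel V `` {\<lambda>n. \<zero>\<^bsub>V\<^esub>},
     add = (\<lambda>P Q. \<Union>s\<in>P. \<Union>t\<in>Q. cauchy_rel V `` {\<lambda>n. s n \<oplus>\<^bsub>V\<^esub> t n}),
     smult = (\<lambda>c P. \<Union>s\<in>P. cauchy_rel V `` {\<lambda>n. c \<odot>\<^bsub>V\<^esub> s n}),
     nrm = (\<lambda>P. the_elem ((\<lambda>s. lim (\<lambda>n. nrm V (s n))) ` P))\<rparr>"

definition completion_emb :: "'b nspace \<Rightarrow> 'b \<Rightarrow> (nat \<Rightarrow> 'b) set"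
  where "completion_emb V v = cauchy_rel V `` {\<lambda>n. v}"


section \<open>Algebraic tensor products\<close>

text \<open>
  As in Ryan's book, \<open>z \<otimes> x\<close> is the evaluation functional \<open>B \<mapsto> B z x\<close> on the space of bilinear
  forms, and \<open>Z \<otimes> X\<close> is the linear span of these functionals. A bilinear form may take
  arbitrary values off the carriers, and a tensor is \<open>0\<close> off the bilinear forms.
\<close>

definition bilinear_forms ::
    "complex set \<Rightarrow> 'z nspace \<Rightarrow> 'x nspace \<Rightarrow> ('z \<Rightarrow> 'x \<Rightarrow> complex) set"
  where "bilinear_forms K Z X =
    {B. (\<forall>z\<in>carrier Z. linear_op K X (scalar_space K) (\<lambda>x. B z x)) \<and>
        (\<forall>x\<in>carrier X. linear_op K Z (scalar_space K) (\<lambda>z. B z x))}"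

type_synonym ('z, 'x) tensor = "('z \<Rightarrow> 'x \<Rightarrow> complex) \<Rightarrow> complex"

definition elem_tensor ::
    "complex set \<Rightarrow> 'z nspace \<Rightarrow> 'x nspace \<Rightarrow> 'z \<Rightarrow> 'x \<Rightarrow> ('z, 'x) tensor"
  where "elem_tensor K Z X z x = (\<lambda>B. if B \<in> bilinear_forms K Z X then B z x else 0)"

text \<open>
  The element \<open>\<Sum>\<^sub>i z\<^sub>i \<otimes> x\<^sub>i\<close> for a list of pairs \<open>(z\<^sub>i, x\<^sub>i)\<close>. Such finite sums already form the
  whole span, since scalars can be absorbed into the first factor.
\<close>

definition tensor_sum ::
    "complex set \<Rightarrow> 'z nspace \<Rightarrow> 'x nspace \<Rightarrow> ('z \<times> 'x) list \<Rightarrow> ('z, 'x) tensor"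
  where "tensor_sum K Z X ps = (\<lambda>B. \<Sum>(z, x)\<leftarrow>ps. elem_tensor K Z X z x B)"

definition tensors :: "complex set \<Rightarrow> 'z nspace \<Rightarrow> 'x nspace \<Rightarrow> ('z, 'x) tensor set"
  where "tensors K Z X = {tensor_sum K Z X ps | ps. set ps \<subseteq> carrier Z \<times> carrier X}"

definition tensor_space ::
    "complex set \<Rightarrow> 'z nspace \<Rightarrow> 'x nspace \<Rightarrow> (('z, 'x) tensor \<Rightarrow> real) \<Rightarrow> ('z, 'x) tensor nspace"
  where "tensor_space K Z X N =
    \<lparr>carrier = tensors K Z X, mult = undefined, one = undefined,
     zero = (\<lambda>B. 0), add = (\<lambda>u v B. u B + v B), smult = (\<lambda>c u B. c * u B), nrm = N\<rparr>"

text \<open>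
  The operator \<open>S \<otimes> T\<close> from \<open>Z \<otimes> X\<close> to \<open>Z' \<otimes> X'\<close>; it maps \<open>z \<otimes> x\<close> to \<open>S z \<otimes> T x\<close>.
\<close>

definition tensor_map ::
    "complex set \<Rightarrow> 'v nspace \<Rightarrow> 'w nspace \<Rightarrow> ('z \<Rightarrow> 'v) \<Rightarrow> ('x \<Rightarrow> 'w)
      \<Rightarrow> ('z, 'x) tensor \<Rightarrow> ('v, 'w) tensor"
  where "tensor_map K Z' X' S T u =
    (\<lambda>B. if B \<in> bilinear_forms K Z' X' then u (\<lambda>z x. B (S z) (T x)) else 0)"


section \<open>Tensor norms\<close>

definition projective_norm ::
    "complex set \<Rightarrow> 'z nspace \<Rightarrow> 'x nspace \<Rightarrow> ('z, 'x) tensor \<Rightarrow> real"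
  where "projective_norm K Z X u =
    Inf {\<Sum>(z, x)\<leftarrow>ps. nrm Z z * nrm X x | ps.
      set ps \<subseteq> carrier Z \<times> carrier X \<and> tensor_sum K Z X ps = u}"

text \<open>For \<open>u = \<Sum>\<^sub>i z\<^sub>i \<otimes> x\<^sub>i\<close>, the value of \<open>u\<close> at the form below is \<open>\<Sum>\<^sub>i \<phi>(z\<^sub>i) \<psi>(x\<^sub>i)\<close>.\<close>

definition injective_norm ::
    "complex set \<Rightarrow> 'z nspace \<Rightarrow> 'x nspace \<Rightarrow> ('z, 'x) tensor \<Rightarrow> real"
  where "injective_norm K Z X u =
    Sup {cmod (u (\<lambda>z x. \<phi> z * \<psi> x)) | \<phi> \<psi>.
      \<phi> \<in> carrier (dual_space K Z) \<and> nrm (dual_space K Z) \<phi> \<le> 1 \<and>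
      \<psi> \<in> carrier (dual_space K X) \<and> nrm (dual_space K X) \<psi> \<le> 1}"

text \<open>
  A tensor norm assigns a norm to each pair of Banach spaces with carriers in the type \<open>'u\<close>.
  In \<open>finitely_generated\<close>, \<open>tensor_map K Z X id id\<close> is the canonical map from \<open>M \<otimes> N\<close> to
  \<open>Z \<otimes> X\<close>.
\<close>

type_synonym 'u tensor_norm = "'u nspace \<Rightarrow> 'u nspace \<Rightarrow> ('u, 'u) tensor \<Rightarrow> real"

locale tensor_norm =
  fixes K :: "complex set" and \<alpha> :: "'u tensor_norm"
  assumes norm: "banach_space K Z \<Longrightarrow> banach_space K X \<Longrightarrow>
      normed_space K (tensor_space K Z X (\<alpha> Z X))"
    and injective_le: "banach_space K Z \<Longrightarrow> banach_space K X \<Longrightarrow> u \<in> tensors K Z X \<Longrightarrow>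
      injective_norm K Z X u \<le> \<alpha> Z X u"
    and le_projective: "banach_space K Z \<Longrightarrow> banach_space K X \<Longrightarrow> u \<in> tensors K Z X \<Longrightarrow>
      \<alpha> Z X u \<le> projective_norm K Z X u"
    and uniform: "banach_space K Z \<Longrightarrow> banach_space K X \<Longrightarrow>
      banach_space K Z' \<Longrightarrow> banach_space K X' \<Longrightarrow>
      S \<in> ops K Z Z' \<Longrightarrow> T \<in> ops K X X' \<Longrightarrow> u \<in> tensors K Z X \<Longrightarrow>
      \<alpha> Z' X' (tensor_map K Z' X' S T u) \<le> op_norm Z Z' S * op_norm X X' T * \<alpha> Z X u"
    and finitely_generated: "banach_space K Z \<Longrightarrow> banach_space K X \<Longrightarrow> u \<in> tensors K Z X \<Longrightarrow>
      \<alpha> Z X u = Inf {\<alpha> (Z\<lparr>carrier := M\<rparr>) (X\<lparr>carrier := N\<rparr>) v | M N v.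
        finite_dim_subspace K Z M \<and> finite_dim_subspace K X N \<and>
        v \<in> tensors K (Z\<lparr>carrier := M\<rparr>) (X\<lparr>carrier := N\<rparr>) \<and>
        tensor_map K Z X id id v = u}"

definition norms_equivalent_on :: "'a set \<Rightarrow> ('a \<Rightarrow> real) \<Rightarrow> ('a \<Rightarrow> real) \<Rightarrow> bool"
  where "norms_equivalent_on V N1 N2 \<longleftrightarrow>
    (\<exists>c>0. \<exists>C>0. \<forall>u\<in>V. c * N1 u \<le> N2 u \<and> N2 u \<le> C * N1 u)"

text \<open>The completed tensor product, and the operator \<open>U\<^sup>#\<close> with \<open>(U\<^sup># z) x = U (z \<otimes> x)\<close>.\<close>

definition completed_tensor ::
    "complex set \<Rightarrow> 'u tensor_norm \<Rightarrow> 'u nspace \<Rightarrow> 'u nspace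
      \<Rightarrow> (nat \<Rightarrow> ('u, 'u) tensor) set nspace"
  where "completed_tensor K \<alpha> Z X = completion (tensor_space K Z X (\<alpha> Z X))"

definition associated_op ::
    "complex set \<Rightarrow> 'u tensor_norm \<Rightarrow> 'u nspace \<Rightarrow> 'u nspace
      \<Rightarrow> ((nat \<Rightarrow> ('u, 'u) tensor) set \<Rightarrow> 'y) \<Rightarrow> 'u \<Rightarrow> 'u \<Rightarrow> 'y"
  where "associated_op K \<alpha> Z X U =
    (\<lambda>z\<in>carrier Z. \<lambda>x\<in>carrier X.
      U (completion_emb (tensor_space K Z X (\<alpha> Z X)) (elem_tensor K Z X z x)))"

text \<open>
  The component \<open>\<A>(Z, X\<^sup>*)\<close> of the dual space operator ideal \<open>\<A>\<close> of \<open>\<alpha>\<close>: the operators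
  \<open>A : Z \<rightarrow> X\<^sup>*\<close> whose functional \<open>\<Sum>\<^sub>i z\<^sub>i \<otimes> x\<^sub>i \<mapsto> \<Sum>\<^sub>i (A z\<^sub>i) (x\<^sub>i)\<close> is \<open>\<alpha>\<close>-bounded.
\<close>

definition dual_ideal ::
    "complex set \<Rightarrow> 'u tensor_norm \<Rightarrow> 'u nspace \<Rightarrow> 'u nspace \<Rightarrow> ('u \<Rightarrow> 'u \<Rightarrow> complex) set"
  where "dual_ideal K \<alpha> Z X =
    {A \<in> ops K Z (dual_space K X).
      \<exists>C. \<forall>ps. set ps \<subseteq> carrier Z \<times> carrier X \<longrightarrow>
        cmod (\<Sum>(z, x)\<leftarrow>ps. A z x) \<le> C * \<alpha> Z X (tensor_sum K Z X ps)}"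

text \<open>
  Every operator \<open>S : Z \<rightarrow> \<L>(X, Y)\<close> is of the form \<open>U\<^sup>#\<close>.
\<close>

definition all_ops_associated ::
    "complex set \<Rightarrow> 'u tensor_norm \<Rightarrow> 'u nspace \<Rightarrow> 'u nspace \<Rightarrow> 'y nspace \<Rightarrow> bool"
  where "all_ops_associated K \<alpha> Z X Y \<longleftrightarrow>
    (\<forall>S \<in> ops K Z (op_space K X Y).
      \<exists>U \<in> ops K (completed_tensor K \<alpha> Z X) Y. associated_op K \<alpha> Z X U = S)"

end

theory Submission
  imports Defs
begin

text \<open>
  Bounded operators \<open>Z \<rightarrow> \<L>(X, Y)\<close> correspond to operators on \<open>Z \<otimes> X\<close> that are bounded for \<open>\<pi>\<close>; if
  \<open>\<pi>\<close> is dominated by \<open>\<alpha>\<close>, these extend to the \<open>\<alpha>\<close>-completion. If one space \<open>Y \<noteq> {0}\<close> has the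
  extension property, apply it to \<open>z \<mapsto> (x \<mapsto> (A z) x \<cdot> y)\<close> with a fixed \<open>y \<noteq> 0\<close> to see that every
  \<open>A : Z \<rightarrow> X\<^sup>*\<close> is \<open>\<alpha>\<close>-bounded. Finally, by the Hahn--Banach theorem \<open>\<pi>\<close> is the supremum of the
  bounded bilinear forms of norm at most one, so by uniform boundedness \<open>\<pi>\<close> is dominated by \<open>\<alpha>\<close> as
  soon as each bounded bilinear form is \<open>\<alpha>\<close>-bounded.
\<close>

text \<open>Functionals are total functions constrained only on carriers, so Hahn--Banach is
  obtained from minimal sublinear functionals rather than by extending functionals through growing
  subspaces: Zorn's lemma then runs over functionals with one fixed domain. The theorem serves
  twice. On \<open>Z \<otimes> X\<close> with \<open>\<pi>\<close> it yields norming forms; on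
  \<open>Y\<close> it yields enough functionals to separate points, which makes the operator
  belonging to a bilinear map independent of how a tensor is written as a sum.

  Uniform boundedness is proved by a gliding hump: a failure of domination is turned into one
  explicit bad form, so that a single series of forms has to converge and the space of all bounded
  forms is never treated as a Banach space. The weights \<open>1 / 3 ^ n\<close> make the tail of
  the series half as large as the current term, and the defects \<open>4 ^ n\<close> outgrow them.

  Clauses (a) and (b) quantify over spaces with carriers in one type \<open>'y\<close>; passing from
  (a) to (b) takes a nonzero space there, namely a copy of the scalar field.\<close>

lemma scalar_ring_simps [simp]:
  "carrier (scalar_ring K) = K" "one (scalar_ring K) = 1" "zero (scalar_ring K) = 0"
  "add (scalar_ring K) = (+)" "mult (scalar_ring K) = (*)"
  by (simp_all add: scalar_ring_def)

lemma scalar_space_simps [simp]: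
  "carrier (scalar_space K) = K" "zero (scalar_space K) = 0" "add (scalar_space K) = (+)"
  "smult (scalar_space K) = (*)" "nrm (scalar_space K) = cmod"
  by (simp_all add: scalar_space_def)

lemma linear_opD:
  assumes "linear_op K V W f"
  shows "x \<in> carrier V \<Longrightarrow> f x \<in> carrier W"
    and "x \<in> carrier V \<Longrightarrow> y \<in> carrier V \<Longrightarrow> f (x \<oplus>\<^bsub>V\<^esub> y) = f x \<oplus>\<^bsub>W\<^esub> f y"
    and "c \<in> K \<Longrightarrow> x \<in> carrier V \<Longrightarrow> f (c \<odot>\<^bsub>V\<^esub> x) = c \<odot>\<^bsub>W\<^esub> f x"
  using assms by (auto simp: linear_op_def)

section \<open>Vector arithmetic and the metric of a normed space\<close>

context normed_space
begin

lemma of_real_scalar [simp]: "complex_of_real r \<in> K"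
  using scalar_field by auto

lemma scalar_arith [simp]:
  "0 \<in> K" "1 \<in> K" "-1 \<in> K" "a \<in> K \<Longrightarrow> -a \<in> K" "a \<in> K \<Longrightarrow> inverse a \<in> K"
  "a \<in> K \<Longrightarrow> b \<in> K \<Longrightarrow> a + b \<in> K" "a \<in> K \<Longrightarrow> b \<in> K \<Longrightarrow> a * b \<in> K"
  using scalar_field by auto

lemma scale_closed [simp]: "c \<in> K \<Longrightarrow> x \<in> carrier V \<Longrightarrow> c \<odot>\<^bsub>V\<^esub> x \<in> carrier V"
  using smult_closed by simp

lemma scale_scale: "a \<in> K \<Longrightarrow> b \<in> K \<Longrightarrow> x \<in> carrier V \<Longrightarrow>
    a \<odot>\<^bsub>V\<^esub> (b \<odot>\<^bsub>V\<^esub> x) = (a * b) \<odot>\<^bsub>V\<^esub> x"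
  using smult_assoc1 by simp

lemma scale_add_left: "a \<in> K \<Longrightarrow> b \<in> K \<Longrightarrow> x \<in> carrier V \<Longrightarrow>
    (a + b) \<odot>\<^bsub>V\<^esub> x = a \<odot>\<^bsub>V\<^esub> x \<oplus> b \<odot>\<^bsub>V\<^esub> x"
  using smult_l_distr by simp

lemma scale_add_right: "a \<in> K \<Longrightarrow> x \<in> carrier V \<Longrightarrow> y \<in> carrier V \<Longrightarrow>
    a \<odot>\<^bsub>V\<^esub> (x \<oplus> y) = a \<odot>\<^bsub>V\<^esub> x \<oplus> a \<odot>\<^bsub>V\<^esub> y"
  using smult_r_distr by simp

lemma scale_one [simp]: "x \<in> carrier V \<Longrightarrow> 1 \<odot>\<^bsub>V\<^esub> x = x"
  using smult_one by simp

lemma scale_zero_left [simp]: "x \<in> carrier V \<Longrightarrow> 0 \<odot>\<^bsub>V\<^esub> x = \<zero>"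
  using smult_l_null by simp

lemma scale_zero_right [simp]: "c \<in> K \<Longrightarrow> c \<odot>\<^bsub>V\<^esub> \<zero> = \<zero>"
  using smult_r_null by simp

lemma uminus_scale: "x \<in> carrier V \<Longrightarrow> \<ominus> x = (-1) \<odot>\<^bsub>V\<^esub> x"
  using scale_add_left[of "-1" 1 x] by (intro M.minus_equality) auto

lemma uminus_zero [simp]: "\<ominus> \<zero> = \<zero>"
  by (simp add: uminus_scale)

lemma nrm_zero [simp]: "nrm V \<zero> = 0"
  by (simp add: nrm_eq_zero_iff)

lemma nrm_uminus [simp]: "x \<in> carrier V \<Longrightarrow> nrm V (\<ominus> x) = nrm V x"
  by (simp add: uminus_scale nrm_smult)

lemma nrm_minus_commute: "x \<in> carrier V \<Longrightarrow> y \<in> carrier V \<Longrightarrow> nrm V (x \<ominus> y) = nrm V (y \<ominus> x)"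
  by (metis M.a_comm M.a_inv_closed M.minus_add M.minus_minus M.minus_closed a_minus_def nrm_uminus)

lemma minus_self [simp]: "x \<in> carrier V \<Longrightarrow> x \<ominus> x = \<zero>"
  by (simp add: a_minus_def M.r_neg)

lemma minus_eq_zero: "x \<in> carrier V \<Longrightarrow> y \<in> carrier V \<Longrightarrow> x \<ominus> y = \<zero> \<Longrightarrow> x = y"
  by (metis M.a_inv_closed M.minus_equality M.minus_minus a_minus_def)

lemma nrm_minus_triangle:
  assumes "x \<in> carrier V" "y \<in> carrier V" "z \<in> carrier V"
  shows "nrm V (x \<ominus> z) \<le> nrm V (x \<ominus> y) + nrm V (y \<ominus> z)"
proof -
  have "x \<ominus> z = (x \<ominus> y) \<oplus> (y \<ominus> z)"
    using assms by (simp add: a_minus_def M.a_assoc M.r_neg1 M.r_neg2)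
  then show ?thesis
    using assms by (simp add: nrm_triangle)
qed

lemma minus_add_distrib:
  assumes "a \<in> carrier V" "b \<in> carrier V" "c \<in> carrier V" "d \<in> carrier V"
  shows "(a \<oplus> b) \<ominus> (c \<oplus> d) = (a \<ominus> c) \<oplus> (b \<ominus> d)"
  using assms by (simp add: a_minus_def M.minus_add M.a_ac)

lemma scale_minus_right:
  assumes "c \<in> K" "a \<in> carrier V" "b \<in> carrier V"
  shows "c \<odot>\<^bsub>V\<^esub> (a \<ominus> b) = (c \<odot>\<^bsub>V\<^esub> a) \<ominus> (c \<odot>\<^bsub>V\<^esub> b)"
  using assms by (simp add: a_minus_def scale_add_right uminus_scale scale_scale)

lemma nrm_diff_le:
  assumes "x \<in> carrier V" "y \<in> carrier V"
  shows "\<bar>nrm V x - nrm V y\<bar> \<le> nrm V (x \<ominus> y)"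
proof -
  have "nrm V x \<le> nrm V (x \<ominus> y) + nrm V y" "nrm V y \<le> nrm V (y \<ominus> x) + nrm V x"
    using nrm_minus_triangle[of x y \<zero>] nrm_minus_triangle[of y x \<zero>] assms
    by (simp_all add: a_minus_def)
  then show ?thesis
    using nrm_minus_commute[OF assms] by linarith
qed

sublocale Metric_space "carrier V" "ndist V"
proof
  fix x y z
  show "0 \<le> ndist V x y"
    by (simp add: ndist_def nrm_nonneg)
  show "ndist V x y = ndist V y x"
    by (simp add: ndist_def nrm_minus_commute)
  show "x \<in> carrier V \<Longrightarrow> y \<in> carrier V \<Longrightarrow> ndist V x y = 0 \<longleftrightarrow> x = y"
    using minus_eq_zero by (auto simp: ndist_def nrm_eq_zero_iff)
  show "x \<in> carrier V \<Longrightarrow> y \<in> carrier V \<Longrightarrow> z \<in> carrier V \<Longrightarrow>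
      ndist V x z \<le> ndist V x y + ndist V y z"
    by (simp add: ndist_def nrm_minus_triangle)
qed


section \<open>The Hahn--Banach theorem\<close>

text \<open>Only real multiples occur, so the notion is the same for both fields. Extensionality
  makes the pointwise order on the carrier antisymmetric, as Zorn's lemma demands. Negative values
  are allowed, since linear functionals are to arise as minimal elements.\<close>

definition sublinear :: "('b \<Rightarrow> real) \<Rightarrow> bool"
  where "sublinear q \<longleftrightarrow> q \<in> extensional (carrier V) \<and>
    (\<forall>x\<in>carrier V. \<forall>y\<in>carrier V. q (x \<oplus> y) \<le> q x + q y) \<and>
    (\<forall>x\<in>carrier V. \<forall>r\<ge>0. q (complex_of_real r \<odot>\<^bsub>V\<^esub> x) = r * q x)"

lemma sublinearD:
  assumes "sublinear q"
  shows "x \<in> carrier V \<Longrightarrow> y \<in> carrier V \<Longrightarrow> q (x \<oplus> y) \<le> q x + q y"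
    and "x \<in> carrier V \<Longrightarrow> 0 \<le> r \<Longrightarrow> q (complex_of_real r \<odot>\<^bsub>V\<^esub> x) = r * q x"
    and "q \<zero> = 0"
    and "x \<in> carrier V \<Longrightarrow> - q (\<ominus> x) \<le> q x"
proof -
  show add: "x \<in> carrier V \<Longrightarrow> y \<in> carrier V \<Longrightarrow> q (x \<oplus> y) \<le> q x + q y" for x y
    using assms by (simp add: sublinear_def)
  show scale: "x \<in> carrier V \<Longrightarrow> 0 \<le> r \<Longrightarrow> q (complex_of_real r \<odot>\<^bsub>V\<^esub> x) = r * q x" for x r
    using assms by (simp add: sublinear_def)
  show zero: "q \<zero> = 0"
    using scale[of \<zero> 0] by simp
  show "x \<in> carrier V \<Longrightarrow> - q (\<ominus> x) \<le> q x"
    using add[of x "\<ominus> x"] zero by (simp add: M.r_neg)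
qed

text \<open>Subhomogeneity for positive factors suffices: the factor \<open>inverse r\<close>
  applied to the multiple of \<open>x\<close> by \<open>r\<close> gives the reverse
  inequality.\<close>

lemma sublinearI:
  assumes "q \<in> extensional (carrier V)"
    and "\<And>x y. x \<in> carrier V \<Longrightarrow> y \<in> carrier V \<Longrightarrow> q (x \<oplus> y) \<le> q x + q y"
    and scale: "\<And>x r. x \<in> carrier V \<Longrightarrow> 0 < r \<Longrightarrow> q (complex_of_real r \<odot>\<^bsub>V\<^esub> x) \<le> r * q x"
    and "q \<zero> = 0"
  shows "sublinear q"
proof -
  have "q (complex_of_real r \<odot>\<^bsub>V\<^esub> x) = r * q x" if "x \<in> carrier V" "0 \<le> r" for x r
  proof (cases "r = 0")
    case False
    with that have "0 < r" by simp
    have "q x \<le> inverse r * q (complex_of_real r \<odot>\<^bsub>V\<^esub> x)"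
      using scale[of "complex_of_real r \<odot>\<^bsub>V\<^esub> x" "inverse r"] \<open>0 < r\<close> that
      by (simp add: scale_scale del: of_real_inverse) (simp flip: of_real_mult)
    then have "r * q x \<le> q (complex_of_real r \<odot>\<^bsub>V\<^esub> x)"
      using \<open>0 < r\<close> by (simp add: field_simps)
    with scale[OF that(1) \<open>0 < r\<close>] show ?thesis by simp
  qed (use assms(4) that in simp)
  then show ?thesis
    using assms by (simp add: sublinear_def)
qed

text \<open>
  The flattening of a sublinear functional is again sublinear and lies below it, so a minimal
  sublinear functional agrees with its flattening in every direction; this forces it to be additive.
\<close>

definition flatten :: "'b \<Rightarrow> ('b \<Rightarrow> real) \<Rightarrow> 'b \<Rightarrow> real"
  where "flatten v q =
    (\<lambda>x\<in>carrier V. INF t\<in>{0..}. q (x \<oplus> complex_of_real t \<odot>\<^bsub>V\<^esub> v) - t * q v)"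

text \<open>The content is that the infimum is finite: writing the multiple of \<open>v\<close> as
  the argument of \<open>q\<close> minus \<open>x\<close>, subadditivity gives the lower bound
  \<open>- q (\<ominus> x)\<close> for every parameter.\<close>

lemma flatten_le:
  assumes "sublinear q" "v \<in> carrier V" "x \<in> carrier V" "0 \<le> t"
  shows "flatten v q x \<le> q (x \<oplus> complex_of_real t \<odot>\<^bsub>V\<^esub> v) - t * q v"
proof -
  have "- q (\<ominus> x) \<le> q (x \<oplus> complex_of_real s \<odot>\<^bsub>V\<^esub> v) - s * q v" if "0 \<le> s" for s
  proof -
    let ?w = "complex_of_real s \<odot>\<^bsub>V\<^esub> v"
    have "(x \<oplus> ?w) \<oplus> (\<ominus> x) = ?w"
      using assms by (simp add: M.a_assoc M.a_comm[of _ "\<ominus> x"] M.r_neg1 M.r_neg2)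
    then have "q ?w \<le> q (x \<oplus> ?w) + q (\<ominus> x)"
      using sublinearD(1)[OF assms(1), of "x \<oplus> ?w" "\<ominus> x"] assms by simp
    then show ?thesis
      using sublinearD(2)[OF assms(1,2) that] by simp
  qed
  then have "bdd_below ((\<lambda>s. q (x \<oplus> complex_of_real s \<odot>\<^bsub>V\<^esub> v) - s * q v) ` {0..})"
    by (auto intro!: bdd_belowI2)
  then show ?thesis
    using assms by (auto simp: flatten_def intro!: cINF_lower)
qed

lemma le_flatten:
  assumes "x \<in> carrier V"
    and "\<And>t. 0 \<le> t \<Longrightarrow> m \<le> q (x \<oplus> complex_of_real t \<odot>\<^bsub>V\<^esub> v) - t * q v"
  shows "m \<le> flatten v q x"
  using assms by (auto simp: flatten_def intro!: cINF_greatest)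

lemma flatten_le_self:
  assumes "sublinear q" "v \<in> carrier V" "x \<in> carrier V"
  shows "flatten v q x \<le> q x"
  using flatten_le[OF assms, of 0] assms by simp

text \<open>The parameters follow the vectors: \<open>s\<close> for \<open>x\<close> and
  \<open>t\<close> for \<open>y\<close> combine to \<open>s + t\<close> for the sum, and scaling
  \<open>x\<close> by \<open>r\<close> scales \<open>t\<close> to \<open>r * t\<close>.\<close>

lemma sublinear_flatten:
  assumes q: "sublinear q" and v: "v \<in> carrier V"
  shows "sublinear (flatten v q)"
proof (rule sublinearI)
  show "flatten v q \<in> extensional (carrier V)"
    by (simp add: flatten_def)
  show "flatten v q (x \<oplus> y) \<le> flatten v q x + flatten v q y"
    if x: "x \<in> carrier V" and y: "y \<in> carrier V" for x y
  proof -
    let ?h = "\<lambda>x t. q (x \<oplus> complex_of_real t \<odot>\<^bsub>V\<^esub> v) - t * q v"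
    have "flatten v q (x \<oplus> y) \<le> ?h x s + ?h y t" if "0 \<le> s" "0 \<le> t" for s t
    proof -
      have "(x \<oplus> y) \<oplus> complex_of_real (s + t) \<odot>\<^bsub>V\<^esub> v =
          (x \<oplus> complex_of_real s \<odot>\<^bsub>V\<^esub> v) \<oplus> (y \<oplus> complex_of_real t \<odot>\<^bsub>V\<^esub> v)"
        using x y v by (simp add: scale_add_left M.a_ac)
      then have "q ((x \<oplus> y) \<oplus> complex_of_real (s + t) \<odot>\<^bsub>V\<^esub> v) \<le>
          q (x \<oplus> complex_of_real s \<odot>\<^bsub>V\<^esub> v) + q (y \<oplus> complex_of_real t \<odot>\<^bsub>V\<^esub> v)"
        using sublinearD(1)[OF q] x y v by simp
      then show ?thesis
        using flatten_le[OF q v, of "x \<oplus> y" "s + t"] x y that by (simp add: algebra_simps)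
    qed
    then have "flatten v q (x \<oplus> y) - ?h y t \<le> flatten v q x" if "0 \<le> t" for t
      using that by (intro le_flatten[OF x]) (simp add: algebra_simps)
    then have "flatten v q (x \<oplus> y) - flatten v q x \<le> flatten v q y"
      by (intro le_flatten[OF y]) (simp add: algebra_simps)
    then show ?thesis by simp
  qed
  show "flatten v q (complex_of_real r \<odot>\<^bsub>V\<^esub> x) \<le> r * flatten v q x"
    if x: "x \<in> carrier V" and r: "0 < r" for x r
  proof -
    have "flatten v q (complex_of_real r \<odot>\<^bsub>V\<^esub> x) / r \<le> q (x \<oplus> complex_of_real t \<odot>\<^bsub>V\<^esub> v) - t * q v"
      if t: "0 \<le> t" for t
    proof -
      have "complex_of_real r \<odot>\<^bsub>V\<^esub> x \<oplus> complex_of_real (r * t) \<odot>\<^bsub>V\<^esub> v =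
          complex_of_real r \<odot>\<^bsub>V\<^esub> (x \<oplus> complex_of_real t \<odot>\<^bsub>V\<^esub> v)"
        using x v by (simp add: scale_add_right scale_scale)
      then have "flatten v q (complex_of_real r \<odot>\<^bsub>V\<^esub> x) \<le>
          r * q (x \<oplus> complex_of_real t \<odot>\<^bsub>V\<^esub> v) - r * t * q v"
        using flatten_le[OF q v, of "complex_of_real r \<odot>\<^bsub>V\<^esub> x" "r * t"] x v r t
        by (simp add: sublinearD(2)[OF q])
      then show ?thesis
        using r by (simp add: field_simps)
    qed
    then have "flatten v q (complex_of_real r \<odot>\<^bsub>V\<^esub> x) / r \<le> flatten v q x"
      by (rule le_flatten[OF x])
    then show ?thesis
      using r by (simp add: field_simps)
  qed
  show "flatten v q \<zero> = 0"
  proof (rule antisym)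
    show "flatten v q \<zero> \<le> 0"
      using flatten_le_self[OF q v] sublinearD(3)[OF q] by fastforce
    show "0 \<le> flatten v q \<zero>"
      using v by (intro le_flatten) (simp_all add: sublinearD(2)[OF q])
  qed
qed

text \<open>An infimum of subadditive functionals need not be subadditive; along a chain it is,
  because two members can be replaced by the smaller one. The common majorant \<open>p\<close> keeps
  the infimum finite, by the lower bound \<open>- p (\<ominus> x)\<close>.\<close>

lemma sublinear_Inf_chain:
  assumes "C \<noteq> {}"
    and C: "\<And>q. q \<in> C \<Longrightarrow> sublinear q \<and> (\<forall>x\<in>carrier V. q x \<le> p x)"
    and chain: "\<And>q q'. q \<in> C \<Longrightarrow> q' \<in> C \<Longrightarrow>
      (\<forall>x\<in>carrier V. q x \<le> q' x) \<or> (\<forall>x\<in>carrier V. q' x \<le> q x)"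
  defines "m \<equiv> (\<lambda>x\<in>carrier V. INF q\<in>C. q x)"
  shows "sublinear m" and "q \<in> C \<Longrightarrow> x \<in> carrier V \<Longrightarrow> m x \<le> q x"
proof -
  have lower: "m x \<le> q x" if "q \<in> C" "x \<in> carrier V" for q x
  proof -
    have "- p (\<ominus> x) \<le> q x" if "q \<in> C" for q
    proof -
      have "q (\<ominus> x) \<le> p (\<ominus> x)" "- q (\<ominus> x) \<le> q x"
        using C[OF that] sublinearD(4)[of q x] \<open>x \<in> carrier V\<close> by auto
      then show ?thesis by simp
    qed
    then have "bdd_below ((\<lambda>q. q x) ` C)"
      by (auto intro!: bdd_belowI2)
    then show ?thesis
      using that by (auto simp: m_def intro!: cINF_lower)
  qed
  then show "q \<in> C \<Longrightarrow> x \<in> carrier V \<Longrightarrow> m x \<le> q x" .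
  have greatest: "b \<le> m x" if "x \<in> carrier V" "\<And>q. q \<in> C \<Longrightarrow> b \<le> q x" for b x
    using that \<open>C \<noteq> {}\<close> by (auto simp: m_def intro!: cINF_greatest)
  show "sublinear m"
  proof (rule sublinearI)
    show "m \<in> extensional (carrier V)"
      by (simp add: m_def)
    show "m (x \<oplus> y) \<le> m x + m y" if x: "x \<in> carrier V" and y: "y \<in> carrier V" for x y
    proof -
      have "m (x \<oplus> y) \<le> q x + q' y" if "q \<in> C" "q' \<in> C" for q q'
      proof -
        obtain q0 where "q0 \<in> C" "q0 x \<le> q x" "q0 y \<le> q' y"
          using chain[OF \<open>q \<in> C\<close> \<open>q' \<in> C\<close>] \<open>q \<in> C\<close> \<open>q' \<in> C\<close> x y by blast
        then show ?thesis
          using lower[of q0 "x \<oplus> y"] sublinearD(1)[of q0 x y] C[of q0] x y by simp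
      qed
      then have "m (x \<oplus> y) - q' y \<le> m x" if "q' \<in> C" for q'
        using that by (intro greatest[OF x]) (simp add: algebra_simps)
      then have "m (x \<oplus> y) - m x \<le> m y"
        by (intro greatest[OF y]) (simp add: algebra_simps)
      then show ?thesis by simp
    qed
    show "m (complex_of_real r \<odot>\<^bsub>V\<^esub> x) \<le> r * m x" if x: "x \<in> carrier V" and r: "0 < r" for x r
    proof -
      have "m (complex_of_real r \<odot>\<^bsub>V\<^esub> x) / r \<le> m x"
        using lower[of _ "complex_of_real r \<odot>\<^bsub>V\<^esub> x"] C sublinearD(2)[of _ x r] x r
        by (intro greatest[OF x]) (fastforce simp: field_simps)
      then show ?thesis
        using r by (simp add: field_simps)
    qed
    have "q \<zero> = 0" if "q \<in> C" for q
      using C[OF that] sublinearD(3) by blast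
    then show "m \<zero> = 0"
      using \<open>C \<noteq> {}\<close> lower[of _ \<zero>] greatest[of \<zero> 0] by (force intro: antisym)
  qed
qed

lemma minimal_sublinear_exists:
  assumes p: "sublinear p"
  obtains m where "sublinear m" "\<And>x. x \<in> carrier V \<Longrightarrow> m x \<le> p x"
    "\<And>q. sublinear q \<Longrightarrow> (\<And>x. x \<in> carrier V \<Longrightarrow> q x \<le> m x) \<Longrightarrow> q = m"
proof -
  define A where "A = {q. sublinear q \<and> (\<forall>x\<in>carrier V. q x \<le> p x)}"
  \<comment> \<open>The order is reversed, so that the maximal elements of Zorn's lemma are the
    minimal functionals.\<close>
  define P where "P = (\<lambda>q q' :: 'b \<Rightarrow> real. \<forall>x\<in>carrier V. q' x \<le> q x)"
  have "\<exists>m\<in>A. \<forall>q\<in>A. P m q \<longrightarrow> q = m"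
  proof (rule predicate_Zorn)
    have "q = q'" if "q \<in> A" "q' \<in> A" "P q q'" "P q' q" for q q'
      using that by (intro extensionalityI[of _ "carrier V"])
        (auto simp: A_def P_def sublinear_def intro: antisym)
    moreover have "P q q''" if "P q q'" "P q' q''" for q q' q''
      using that by (force simp: P_def)
    ultimately show "partial_order_on A (relation_of P A)"
      by (intro partial_order_on_relation_ofI) (auto simp: P_def)
  next
    fix C assume C: "C \<in> Chains (relation_of P A)"
    then have CA: "C \<subseteq> A" and chain: "\<And>q q'. q \<in> C \<Longrightarrow> q' \<in> C \<Longrightarrow> P q q' \<or> P q' q"
      by (auto simp: Chains_def relation_of_def)
    show "\<exists>u\<in>A. \<forall>q\<in>C. P q u"
    proof (cases "C = {}")
      case True
      then show ?thesis
        using p by (auto simp: A_def)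
    next
      case False
      let ?m = "\<lambda>x\<in>carrier V. INF q\<in>C. q x"
      note * = sublinear_Inf_chain[of C p, OF False]
      have "sublinear ?m"
        by (rule *) (use CA chain in \<open>auto simp: A_def P_def\<close>)
      moreover have lower: "?m x \<le> q x" if "q \<in> C" "x \<in> carrier V" for q x
        by (rule *) (use CA chain that in \<open>auto simp: A_def P_def\<close>)
      moreover have "?m x \<le> p x" if x: "x \<in> carrier V" for x
      proof -
        obtain q where "q \<in> C" using False by blast
        then have "?m x \<le> q x" "q x \<le> p x"
          using lower x CA by (auto simp: A_def)
        then show ?thesis by simp
      qed
      ultimately show ?thesis
        by (intro bexI[of _ ?m]) (auto simp: A_def P_def)
    qed
  qed
  then obtain m where "m \<in> A" and min: "\<And>q. q \<in> A \<Longrightarrow> P m q \<Longrightarrow> q = m"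
    by blast
  show thesis
  proof (rule that)
    show "sublinear m" "\<And>x. x \<in> carrier V \<Longrightarrow> m x \<le> p x"
      using \<open>m \<in> A\<close> by (auto simp: A_def)
    show "q = m" if "sublinear q" "\<And>x. x \<in> carrier V \<Longrightarrow> q x \<le> m x" for q
      using that \<open>m \<in> A\<close> by (intro min) (force simp: A_def P_def)+
  qed
qed

text \<open>By minimality \<open>flatten y m = m\<close>, and the parameter 1 in the infimum gives
  \<open>m x \<le> m (x \<oplus> y) - m y\<close>, the converse of subadditivity. Negative factors
  follow, since the multiples by \<open>r\<close> and \<open>- r\<close> add up to zero.\<close>

lemma minimal_sublinear_linear:
  assumes m: "sublinear m"
    and min: "\<And>q. sublinear q \<Longrightarrow> (\<And>x. x \<in> carrier V \<Longrightarrow> q x \<le> m x) \<Longrightarrow> q = m"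
  shows "x \<in> carrier V \<Longrightarrow> y \<in> carrier V \<Longrightarrow> m (x \<oplus> y) = m x + m y"
    and "x \<in> carrier V \<Longrightarrow> m (complex_of_real r \<odot>\<^bsub>V\<^esub> x) = r * m x"
proof -
  show add: "m (x \<oplus> y) = m x + m y" if "x \<in> carrier V" "y \<in> carrier V" for x y
  proof (rule antisym)
    have "flatten y m = m"
      using m that by (intro min sublinear_flatten flatten_le_self)
    then show "m x + m y \<le> m (x \<oplus> y)"
      using flatten_le[OF m that(2,1), of 1] that by simp
  qed (use sublinearD(1)[OF m] that in simp)
  show "m (complex_of_real r \<odot>\<^bsub>V\<^esub> x) = r * m x" if x: "x \<in> carrier V"
  proof (cases "0 \<le> r")
    case False
    have "complex_of_real r \<odot>\<^bsub>V\<^esub> x \<oplus> complex_of_real (- r) \<odot>\<^bsub>V\<^esub> x = \<zero>"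
      using scale_add_left[of "of_real r" "of_real (-r)" x] x by simp
    then have "m (complex_of_real r \<odot>\<^bsub>V\<^esub> x) + m (complex_of_real (- r) \<odot>\<^bsub>V\<^esub> x) = 0"
      using add[of "of_real r \<odot>\<^bsub>V\<^esub> x" "of_real (- r) \<odot>\<^bsub>V\<^esub> x"] sublinearD(3)[OF m] x by simp
    moreover have "m (complex_of_real (- r) \<odot>\<^bsub>V\<^esub> x) = - r * m x"
      using sublinearD(2)[OF m x, of "- r"] False by linarith
    ultimately show ?thesis by simp
  qed (use sublinearD(2)[OF m x] in simp)
qed

text \<open>Minimising below the norm alone would not fix the value at \<open>v\<close>; hence the
  start is the norm flattened along \<open>v\<close>. Its value at \<open>\<ominus> v\<close> is at
  most \<open>nrm V \<zero> - nrm V v\<close> (parameter 1), which forces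
  \<open>m v \<ge> nrm V v\<close>.\<close>

theorem real_norming_functional:
  assumes v: "v \<in> carrier V"
  obtains m where "\<And>x y. x \<in> carrier V \<Longrightarrow> y \<in> carrier V \<Longrightarrow> m (x \<oplus> y) = m x + m y"
    and "\<And>x r. x \<in> carrier V \<Longrightarrow> m (complex_of_real r \<odot>\<^bsub>V\<^esub> x) = r * m x"
    and "\<And>x. x \<in> carrier V \<Longrightarrow> m x \<le> nrm V x" and "m v = nrm V v"
proof -
  define p where "p = (\<lambda>x\<in>carrier V. nrm V x)"
  have p: "sublinear p"
    by (rule sublinearI) (auto simp: p_def nrm_triangle nrm_smult)
  obtain m where m: "sublinear m" and le: "\<And>x. x \<in> carrier V \<Longrightarrow> m x \<le> flatten v p x"
    and min: "\<And>q. sublinear q \<Longrightarrow> (\<And>x. x \<in> carrier V \<Longrightarrow> q x \<le> m x) \<Longrightarrow> q = m"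
    using minimal_sublinear_exists[OF sublinear_flatten[OF p v]] by blast
  have linear: "x \<in> carrier V \<Longrightarrow> y \<in> carrier V \<Longrightarrow> m (x \<oplus> y) = m x + m y"
      "x \<in> carrier V \<Longrightarrow> m (complex_of_real r \<odot>\<^bsub>V\<^esub> x) = r * m x" for x y r
    using minimal_sublinear_linear[OF m, of x] min by blast+
  have le_nrm: "m x \<le> nrm V x" if "x \<in> carrier V" for x
    using le[OF that] flatten_le_self[OF p v that] that by (simp add: p_def)
  have "m (\<ominus> v) \<le> - nrm V v"
    using le[of "\<ominus> v"] flatten_le[OF p v, of "\<ominus> v" 1] v by (simp add: p_def M.l_neg)
  moreover have "m (\<ominus> v) = - m v"
    using linear(2)[OF v, of "-1"] v by (simp add: uminus_scale)
  ultimately have "m v = nrm V v"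
    using le_nrm[OF v] by simp
  with linear le_nrm show thesis
    by (intro that[of m])
qed

theorem norming_functional:
  assumes v: "v \<in> carrier V"
  obtains g where "linear_op K V (scalar_space K) g"
    and "\<And>x. x \<in> carrier V \<Longrightarrow> cmod (g x) \<le> nrm V x" and "g v = of_real (nrm V v)"
proof -
  obtain m where add: "\<And>x y. x \<in> carrier V \<Longrightarrow> y \<in> carrier V \<Longrightarrow> m (x \<oplus> y) = m x + m y"
    and scale: "\<And>x r. x \<in> carrier V \<Longrightarrow> m (complex_of_real r \<odot>\<^bsub>V\<^esub> x) = r * m x"
    and le: "\<And>x. x \<in> carrier V \<Longrightarrow> m x \<le> nrm V x" and mv: "m v = nrm V v"
    using real_norming_functional[OF v] by blast
  from scalar_field show thesis
  proof
    assume K: "K = \<real>"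
    show thesis
    proof (rule that)
      show "linear_op K V (scalar_space K) (\<lambda>x. of_real (m x))"
        using K by (auto simp: linear_op_def add elim!: Reals_cases simp: scale)
      show "cmod (of_real (m x)) \<le> nrm V x" if "x \<in> carrier V" for x
        using le[of x] le[of "\<ominus> x"] scale[of x "-1"] that by (simp add: uminus_scale nrm_smult abs_le_iff)
      show "complex_of_real (m v) = of_real (nrm V v)"
        by (simp add: mv)
    qed
  next
    assume K: "K = UNIV"
    \<comment> \<open>The unique complex-linear functional with real part \<open>m\<close>.\<close>
    define g where "g x = Complex (m x) (- m (\<i> \<odot>\<^bsub>V\<^esub> x))" for x
    have g_scale: "g (c \<odot>\<^bsub>V\<^esub> x) = c * g x" if x: "x \<in> carrier V" for c x
    proof -
      have *: "m (d \<odot>\<^bsub>V\<^esub> x) = Re d * m x + Im d * m (\<i> \<odot>\<^bsub>V\<^esub> x)" for d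
      proof -
        have "d \<odot>\<^bsub>V\<^esub> x = of_real (Re d) \<odot>\<^bsub>V\<^esub> x \<oplus> of_real (Im d) \<odot>\<^bsub>V\<^esub> (\<i> \<odot>\<^bsub>V\<^esub> x)"
          using x K by (simp add: scale_scale flip: scale_add_left) (metis complex_eq mult.commute)
        then show ?thesis
          using x K by (simp add: add scale)
      qed
      have "\<i> \<odot>\<^bsub>V\<^esub> (c \<odot>\<^bsub>V\<^esub> x) = (\<i> * c) \<odot>\<^bsub>V\<^esub> x"
        using x K by (simp add: scale_scale)
      then show ?thesis
        by (simp add: g_def *[of c] *[of "\<i> * c"] complex_eq_iff algebra_simps)
    qed
    have g_add: "g (x \<oplus> y) = g x + g y" if "x \<in> carrier V" "y \<in> carrier V" for x y
      using that K by (simp add: g_def add scale_add_right complex_eq_iff)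
    have g_le: "cmod (g x) \<le> nrm V x" if x: "x \<in> carrier V" for x
    proof -
      \<comment> \<open>Multiplication by \<open>c\<close> rotates \<open>g x\<close> onto the
        nonnegative axis, where \<open>g\<close> agrees with its real part \<open>m\<close>, for
        which the bound is known.\<close>
      define c where "c = cnj (sgn (g x))"
      have c: "c * g x = of_real (cmod (g x))" "cmod c \<le> 1"
        using complex_norm_square[of "g x"]
        by (cases "g x = 0"; simp add: c_def sgn_eq norm_divide power2_eq_square mult.commute field_simps)+
      have "cmod (g x) = Re (g (c \<odot>\<^bsub>V\<^esub> x))"
        using g_scale[OF x, of c] c by simp
      also have "\<dots> \<le> nrm V (c \<odot>\<^bsub>V\<^esub> x)"
        using le[of "c \<odot>\<^bsub>V\<^esub> x"] x K by (simp add: g_def)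
      also have "\<dots> \<le> nrm V x"
        using x K c(2) mult_right_mono[OF c(2) nrm_nonneg[OF x]] by (simp add: nrm_smult)
      finally show ?thesis .
    qed
    have "Re (g v) = nrm V v"
      by (simp add: g_def mv)
    moreover have "cmod (g v) \<le> nrm V v"
      by (rule g_le[OF v])
    \<comment> \<open>The real part of \<open>g v\<close> already exhausts the bound on its modulus,
      so no imaginary part is left.\<close>
    ultimately have "cmod (g v) = \<bar>Re (g v)\<bar>"
      using abs_Re_le_cmod[of "g v"] by linarith
    then have "Im (g v) = 0"
      using cmod_power2[of "g v"] by simp
    with \<open>Re (g v) = nrm V v\<close> have "g v = of_real (nrm V v)"
      by (simp add: complex_eq_iff)
    with g_add g_scale g_le show thesis
      using K by (intro that[of g]) (auto simp: linear_op_def)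
  qed
qed

end


section \<open>Operator spaces\<close>

lemma op_space_simps [simp]:
  "zero (op_space K V W) = (\<lambda>x\<in>carrier V. \<zero>\<^bsub>W\<^esub>)"
  "add (op_space K V W) = (\<lambda>f g. \<lambda>x\<in>carrier V. f x \<oplus>\<^bsub>W\<^esub> g x)"
  "smult (op_space K V W) = (\<lambda>c f. \<lambda>x\<in>carrier V. c \<odot>\<^bsub>W\<^esub> f x)"
  "nrm (op_space K V W) = op_norm V W"
  by (simp_all add: op_space_def)

lemma mem_ops:
  "f \<in> ops K V W \<longleftrightarrow> f \<in> extensional (carrier V) \<and> linear_op K V W f \<and>
    (\<exists>C. \<forall>x\<in>carrier V. nrm W (f x) \<le> C * nrm V x)"
  by (auto simp: op_space_def)

lemma op_norm_bound:
  assumes "normed_space K V" "normed_space K W" and f: "f \<in> ops K V W" and x: "x \<in> carrier V"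
  shows "nrm W (f x) \<le> op_norm V W f * nrm V x"
proof -
  interpret V: normed_space K V by fact
  interpret W: normed_space K W by fact
  obtain C where C: "\<And>x. x \<in> carrier V \<Longrightarrow> nrm W (f x) \<le> C * nrm V x" and lin: "linear_op K V W f"
    using f by (auto simp: mem_ops)
  show ?thesis
  proof (cases "nrm V x = 0")
    case True
    then show ?thesis
      using C[OF x] by simp
  next
    case False
    with V.nrm_nonneg[OF x] have pos: "0 < nrm V x" by simp
    define c where "c = complex_of_real (1 / nrm V x)"
    have c: "c \<in> K" "cmod c = 1 / nrm V x"
      unfolding c_def using pos by (simp_all del: of_real_divide add: norm_of_real)
    \<comment> \<open>Membership in \<open>ops\<close> does not fix the sign of \<open>C\<close>: on
      the zero space any constant will do. Hence the absolute value.\<close>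
    have "C * nrm V y \<le> \<bar>C\<bar>" if "y \<in> carrier V" "nrm V y \<le> 1" for y
    proof -
      have "C * nrm V y \<le> \<bar>C\<bar> * nrm V y"
        using V.nrm_nonneg[OF that(1)] by (simp add: mult_right_mono)
      also have "\<dots> \<le> \<bar>C\<bar> * 1"
        using that(2) by (intro mult_left_mono) auto
      finally show ?thesis by simp
    qed
    with C have "nrm W (f y) \<le> \<bar>C\<bar>" if "y \<in> carrier V" "nrm V y \<le> 1" for y
      using that by (meson order_trans)
    then have "bdd_above {nrm W (f y) | y. y \<in> carrier V \<and> nrm V y \<le> 1}"
      by (intro bdd_aboveI[of _ "\<bar>C\<bar>"]) blast
    moreover have "nrm W (f (c \<odot>\<^bsub>V\<^esub> x)) \<in> {nrm W (f y) | y. y \<in> carrier V \<and> nrm V y \<le> 1}"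
      using c x pos by (auto simp: V.nrm_smult)
    ultimately have "nrm W (f (c \<odot>\<^bsub>V\<^esub> x)) \<le> op_norm V W f"
      unfolding op_norm_def by (rule cSup_upper[rotated])
    then show ?thesis
      using linear_opD[OF lin] c x pos by (simp add: W.nrm_smult field_simps)
  qed
qed

lemma op_norm_le:
  assumes "normed_space K V" "0 \<le> C" "\<And>x. x \<in> carrier V \<Longrightarrow> nrm W (f x) \<le> C * nrm V x"
  shows "op_norm V W f \<le> C"
proof -
  interpret V: normed_space K V by fact
  have "\<exists>x. x \<in> carrier V \<and> nrm V x \<le> 1"
    by (intro exI[of _ "\<zero>\<^bsub>V\<^esub>"]) simp
  moreover have "nrm W (f x) \<le> C" if "x \<in> carrier V" "nrm V x \<le> 1" for x
    using assms(3)[OF that(1)] mult_left_mono[OF that(2) assms(2)] by simp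
  ultimately show ?thesis
    unfolding op_norm_def by (intro cSup_least) auto
qed

section \<open>Bilinear maps as operators into an operator space\<close>

definition bilinear_op ::
    "complex set \<Rightarrow> 'z nspace \<Rightarrow> 'x nspace \<Rightarrow> 'y nspace \<Rightarrow> ('z \<Rightarrow> 'x \<Rightarrow> 'y) \<Rightarrow> bool"
  where "bilinear_op K Z X Y S \<longleftrightarrow>
    (\<forall>z\<in>carrier Z. linear_op K X Y (\<lambda>x. S z x)) \<and> (\<forall>x\<in>carrier X. linear_op K Z Y (\<lambda>z. S z x))"

lemma bilinear_forms_eq: "bilinear_forms K Z X = {B. bilinear_op K Z X (scalar_space K) B}"
  by (simp add: bilinear_forms_def bilinear_op_def)

lemma bilinear_op_of_ops:
  assumes "normed_space K Z" "normed_space K X" "normed_space K Y"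
    and S: "S \<in> ops K Z (op_space K X Y)"
  shows "bilinear_op K Z X Y S"
    and "\<exists>C>0. \<forall>z\<in>carrier Z. \<forall>x\<in>carrier X. nrm Y (S z x) \<le> C * (nrm Z z * nrm X x)"
proof -
  interpret Z: normed_space K Z by fact
  interpret X: normed_space K X by fact
  interpret Y: normed_space K Y by fact
  have lin: "linear_op K Z (op_space K X Y) S"
    using S by (simp add: mem_ops)
  have Sz: "S z \<in> ops K X Y" if "z \<in> carrier Z" for z
    using linear_opD(1)[OF lin that] .
  have linz: "linear_op K X Y (S z)" if "z \<in> carrier Z" for z
    using Sz[OF that] by (simp add: mem_ops)
  moreover have "linear_op K Z Y (\<lambda>z. S z x)" if x: "x \<in> carrier X" for x
    unfolding linear_op_def
    using x linear_opD(1)[OF linz] linear_opD(2,3)[OF lin] by auto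
  ultimately show "bilinear_op K Z X Y S"
    by (simp add: bilinear_op_def)
  obtain C where C: "\<And>z. z \<in> carrier Z \<Longrightarrow> op_norm X Y (S z) \<le> C * nrm Z z"
    using S by (auto simp: mem_ops)
  \<comment> \<open>The added 1 makes the constant strictly positive; \<open>tensor_lift\<close>
    divides by it.\<close>
  have "nrm Y (S z x) \<le> (\<bar>C\<bar> + 1) * (nrm Z z * nrm X x)"
    if z: "z \<in> carrier Z" and x: "x \<in> carrier X" for z x
  proof -
    have "nrm Y (S z x) \<le> op_norm X Y (S z) * nrm X x"
      using op_norm_bound[OF assms(2,3) Sz[OF z] x] .
    also have "\<dots> \<le> C * nrm Z z * nrm X x"
      using C[OF z] X.nrm_nonneg[OF x] by (rule mult_right_mono)
    also have "\<dots> \<le> (\<bar>C\<bar> + 1) * nrm Z z * nrm X x"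
      using Z.nrm_nonneg[OF z] X.nrm_nonneg[OF x] by (intro mult_right_mono) auto
    finally show ?thesis by (simp add: mult.assoc)
  qed
  then show "\<exists>C>0. \<forall>z\<in>carrier Z. \<forall>x\<in>carrier X. nrm Y (S z x) \<le> C * (nrm Z z * nrm X x)"
    by (intro exI[of _ "\<bar>C\<bar> + 1"]) auto
qed

text \<open>Currying a bounded bilinear map. Both levels are restricted because operator spaces
  contain only extensional functions.\<close>

lemma ops_of_bilinear_op:
  assumes "normed_space K Z" "normed_space K X"
    and S: "bilinear_op K Z X Y S" and "0 \<le> C"
    and C: "\<And>z x. z \<in> carrier Z \<Longrightarrow> x \<in> carrier X \<Longrightarrow> nrm Y (S z x) \<le> C * (nrm Z z * nrm X x)"
  shows "(\<lambda>z\<in>carrier Z. \<lambda>x\<in>carrier X. S z x) \<in> ops K Z (op_space K X Y)"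
proof -
  interpret Z: normed_space K Z by fact
  interpret X: normed_space K X by fact
  let ?S = "\<lambda>z\<in>carrier Z. \<lambda>x\<in>carrier X. S z x"
  have linz: "linear_op K X Y (S z)" if "z \<in> carrier Z" for z
    using S that by (simp add: bilinear_op_def)
  have linx: "linear_op K Z Y (\<lambda>z. S z x)" if "x \<in> carrier X" for x
    using S that by (simp add: bilinear_op_def)
  have "?S z \<in> ops K X Y" if z: "z \<in> carrier Z" for z
    unfolding mem_ops
  proof (intro conjI exI ballI)
    show "linear_op K X Y (?S z)"
      using z linear_opD[OF linz[OF z]] by (auto simp: linear_op_def)
    show "nrm Y (?S z x) \<le> (C * nrm Z z) * nrm X x" if "x \<in> carrier X" for x
      using C z that by (simp add: mult.assoc)
  qed (use z in simp)
  then have "linear_op K Z (op_space K X Y) ?S"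
    using linear_opD[OF linx] by (auto simp: linear_op_def restrict_def fun_eq_iff)
  moreover have "op_norm X Y (?S z) \<le> C * nrm Z z" if z: "z \<in> carrier Z" for z
    using z C Z.nrm_nonneg[OF z] \<open>0 \<le> C\<close>
    by (intro op_norm_le[OF assms(2)]) (auto simp: mult.assoc)
  ultimately show ?thesis
    unfolding mem_ops by (auto intro!: exI[of _ C])
qed


section \<open>Extension to the completion\<close>

definition converges :: "'b nspace \<Rightarrow> (nat \<Rightarrow> 'b) \<Rightarrow> 'b \<Rightarrow> bool"
  where "converges V s y \<longleftrightarrow>
    range s \<subseteq> carrier V \<and> y \<in> carrier V \<and> (\<lambda>n. nrm V (s n \<ominus>\<^bsub>V\<^esub> y)) \<longlonglongrightarrow> 0"

lemma null_seq_le: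
  fixes f :: "nat \<Rightarrow> real"
  assumes "g \<longlonglongrightarrow> 0" "h \<longlonglongrightarrow> 0" "\<And>n. 0 \<le> f n" "\<And>n. f n \<le> g n + h n"
  shows "f \<longlonglongrightarrow> 0"
  using tendsto_add[OF assms(1,2)] assms(3,4)
  by (intro tendsto_sandwich[of "\<lambda>_. 0" f sequentially "\<lambda>n. g n + h n"]) auto

context normed_space
begin

lemma MCauchy_iff:
  "MCauchy s \<longleftrightarrow> range s \<subseteq> carrier V \<and>
    (\<forall>\<epsilon>>0. \<exists>N. \<forall>n\<ge>N. \<forall>m\<ge>N. nrm V (s n \<ominus> s m) < \<epsilon>)"
proof -
  have "ndist V (s n) (s m) = nrm V (s n \<ominus> s m)" if "range s \<subseteq> carrier V" for n m
    using that by (auto simp: ndist_def image_subset_iff)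
  then show ?thesis
    unfolding MCauchy_def by (auto 0 4)
qed

lemma MCauchy_closed: "MCauchy s \<Longrightarrow> s n \<in> carrier V"
  by (auto simp: MCauchy_iff)

lemma converges_unique:
  assumes "converges V s y" "converges V s y'"
  shows "y = y'"
proof -
  have "nrm V (y \<ominus> y') \<le> nrm V (s n \<ominus> y) + nrm V (s n \<ominus> y')" for n
    using nrm_minus_triangle[of y "s n" y'] nrm_minus_commute[of y "s n"] assms
    by (auto simp: converges_def)
  moreover have "(\<lambda>n. nrm V (s n \<ominus> y) + nrm V (s n \<ominus> y')) \<longlonglongrightarrow> 0 + 0"
    using assms unfolding converges_def by (intro tendsto_add) auto
  ultimately have "nrm V (y \<ominus> y') \<le> 0"
    using LIMSEQ_le_const[of _ "0 + 0 :: real"] by fastforce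
  then show ?thesis
    using assms nrm_nonneg[of "y \<ominus> y'"] minus_eq_zero[of y y']
    by (simp add: converges_def nrm_eq_zero_iff)
qed

lemma converges_add:
  assumes "converges V s y" "converges V t z"
  shows "converges V (\<lambda>n. s n \<oplus> t n) (y \<oplus> z)"
proof -
  have mem: "s n \<in> carrier V" "t n \<in> carrier V" "y \<in> carrier V" "z \<in> carrier V" for n
    using assms by (auto simp: converges_def)
  have "(\<lambda>n. nrm V ((s n \<oplus> t n) \<ominus> (y \<oplus> z))) \<longlonglongrightarrow> 0"
    by (rule null_seq_le[of "\<lambda>n. nrm V (s n \<ominus> y)" "\<lambda>n. nrm V (t n \<ominus> z)"])
      (use mem assms in \<open>auto simp: converges_def minus_add_distrib nrm_triangle nrm_nonneg\<close>)
  then show ?thesis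
    using mem by (auto simp: converges_def)
qed

lemma converges_scale:
  assumes "converges V s y" "c \<in> K"
  shows "converges V (\<lambda>n. c \<odot>\<^bsub>V\<^esub> s n) (c \<odot>\<^bsub>V\<^esub> y)"
proof -
  have mem: "s n \<in> carrier V" "y \<in> carrier V" for n
    using assms by (auto simp: converges_def)
  have "(\<lambda>n. cmod c * nrm V (s n \<ominus> y)) \<longlonglongrightarrow> cmod c * 0"
    using assms unfolding converges_def by (intro tendsto_mult) auto
  then show ?thesis
    using mem assms(2) by (auto simp: converges_def nrm_smult simp flip: scale_minus_right)
qed

lemma nrm_tendsto:
  assumes "range s \<subseteq> carrier V" "range t \<subseteq> carrier V"
    and "(\<lambda>n. nrm V (s n \<ominus> t n)) \<longlonglongrightarrow> 0" "(\<lambda>n. nrm V (t n)) \<longlonglongrightarrow> L"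
  shows "(\<lambda>n. nrm V (s n)) \<longlonglongrightarrow> L"
proof -
  have "(\<lambda>n. nrm V (s n) - nrm V (t n)) \<longlonglongrightarrow> 0"
    using assms(1,2) by (intro Lim_null_comparison[OF _ assms(3)])
      (auto intro!: always_eventually nrm_diff_le)
  from tendsto_add[OF this assms(4)] show ?thesis by simp
qed

text \<open>A Lipschitz comparison between two possibly different spaces. It covers scalar
  multiples, images under a bounded operator, and the passage back along an isometric copy.\<close>

lemma MCauchy_of_bound:
  assumes "MCauchy s" "range t \<subseteq> carrier W"
    and C: "\<And>n m. nrm W (t n \<ominus>\<^bsub>W\<^esub> t m) \<le> C * nrm V (s n \<ominus> s m)"
    and W: "normed_space K W"
  shows "Metric_space.MCauchy (carrier W) (ndist W) t"
proof -
  interpret W: normed_space K W by fact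
  have "\<exists>N. \<forall>n\<ge>N. \<forall>m\<ge>N. nrm W (t n \<ominus>\<^bsub>W\<^esub> t m) < \<epsilon>" if "\<epsilon> > 0" for \<epsilon>
  proof -
    have pos: "\<epsilon> / (\<bar>C\<bar> + 1) > 0" using that by simp
    then obtain N where N: "\<And>n m. n \<ge> N \<Longrightarrow> m \<ge> N \<Longrightarrow> nrm V (s n \<ominus> s m) < \<epsilon> / (\<bar>C\<bar> + 1)"
      using assms(1) unfolding MCauchy_iff by meson
    have "nrm W (t n \<ominus>\<^bsub>W\<^esub> t m) < \<epsilon>" if "n \<ge> N" "m \<ge> N" for n m
    proof -
      have "C * nrm V (s n \<ominus> s m) \<le> (\<bar>C\<bar> + 1) * nrm V (s n \<ominus> s m)"
        using MCauchy_closed[OF assms(1)] by (intro mult_right_mono nrm_nonneg) auto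
      also have "\<dots> < \<epsilon>"
        using N[OF that] by (simp add: field_simps)
      finally show ?thesis
        using C[of n m] by simp
    qed
    then show ?thesis by blast
  qed
  with assms(2) show ?thesis
    by (simp add: W.MCauchy_iff)
qed

lemma MCauchy_add:
  assumes "MCauchy s" "MCauchy t"
  shows "MCauchy (\<lambda>n. s n \<oplus> t n)"
proof -
  have "\<exists>N. \<forall>n\<ge>N. \<forall>m\<ge>N. nrm V ((s n \<oplus> t n) \<ominus> (s m \<oplus> t m)) < \<epsilon>" if "\<epsilon> > 0" for \<epsilon>
  proof -
    have pos: "\<epsilon> / 2 > 0" using that by simp
    obtain M N where MN: "\<And>n m. n \<ge> M \<Longrightarrow> m \<ge> M \<Longrightarrow> nrm V (s n \<ominus> s m) < \<epsilon> / 2"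
      "\<And>n m. n \<ge> N \<Longrightarrow> m \<ge> N \<Longrightarrow> nrm V (t n \<ominus> t m) < \<epsilon> / 2"
      using assms pos unfolding MCauchy_iff by meson
    have "nrm V ((s n \<oplus> t n) \<ominus> (s m \<oplus> t m)) < \<epsilon>" if "n \<ge> max M N" "m \<ge> max M N" for n m
    proof -
      have "nrm V ((s n \<oplus> t n) \<ominus> (s m \<oplus> t m)) \<le> nrm V (s n \<ominus> s m) + nrm V (t n \<ominus> t m)"
        using assms by (simp add: minus_add_distrib nrm_triangle MCauchy_closed)
      then show ?thesis
        using MN(1)[of n m] MN(2)[of n m] that by simp
    qed
    then show ?thesis by blast
  qed
  then show ?thesis
    using MCauchy_closed[OF assms(1)] MCauchy_closed[OF assms(2)] by (auto simp: MCauchy_iff)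
qed

lemma MCauchy_scale:
  assumes "MCauchy s" "c \<in> K"
  shows "MCauchy (\<lambda>n. c \<odot>\<^bsub>V\<^esub> s n)"
  by (rule MCauchy_of_bound[OF assms(1), of _ V "cmod c"])
    (use assms MCauchy_closed in \<open>auto simp: nrm_smult normed_space_axioms simp flip: scale_minus_right\<close>)

lemma convergent_nrm_MCauchy:
  assumes "MCauchy s"
  shows "convergent (\<lambda>n. nrm V (s n))"
proof -
  have "Cauchy (\<lambda>n. nrm V (s n))"
  proof (rule metric_CauchyI)
    fix \<epsilon> :: real assume "\<epsilon> > 0"
    then obtain N where "\<And>n m. n \<ge> N \<Longrightarrow> m \<ge> N \<Longrightarrow> nrm V (s n \<ominus> s m) < \<epsilon>"
      using assms unfolding MCauchy_iff by meson
    moreover have "dist (nrm V (s m)) (nrm V (s n)) \<le> nrm V (s m \<ominus> s n)" for m n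
      using nrm_diff_le MCauchy_closed[OF assms] by (simp add: dist_real_def)
    ultimately have "\<forall>m\<ge>N. \<forall>n\<ge>N. dist (nrm V (s m)) (nrm V (s n)) < \<epsilon>"
      by (meson le_less_trans)
    then show "\<exists>N. \<forall>m\<ge>N. \<forall>n\<ge>N. dist (nrm V (s m)) (nrm V (s n)) < \<epsilon>" by blast
  qed
  then show ?thesis by (simp add: Cauchy_convergent_iff)
qed

section \<open>The completion as a quotient of Cauchy sequences\<close>

lemma cauchy_rel_iff:
  "(s, t) \<in> cauchy_rel V \<longleftrightarrow> MCauchy s \<and> MCauchy t \<and> (\<lambda>n. nrm V (s n \<ominus> t n)) \<longlonglongrightarrow> 0"
  by (auto simp: cauchy_rel_def ndist_def MCauchy_closed)

lemma equiv_cauchy_rel: "equiv {s. MCauchy s} (cauchy_rel V)"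
proof (rule equivI)
  show "cauchy_rel V \<subseteq> {s. MCauchy s} \<times> {s. MCauchy s}"
    by (auto simp: cauchy_rel_iff)
  show "refl_on {s. MCauchy s} (cauchy_rel V)"
    by (auto simp: refl_on_def cauchy_rel_iff MCauchy_closed)
  show "sym (cauchy_rel V)"
    by (auto simp: sym_def cauchy_rel_iff MCauchy_closed nrm_minus_commute)
  show "trans (cauchy_rel V)"
  proof (rule transI)
    fix s t u assume st: "(s, t) \<in> cauchy_rel V" and tu: "(t, u) \<in> cauchy_rel V"
    have "(\<lambda>n. nrm V (s n \<ominus> u n)) \<longlonglongrightarrow> 0"
      by (rule null_seq_le[of "\<lambda>n. nrm V (s n \<ominus> t n)" "\<lambda>n. nrm V (t n \<ominus> u n)"])
        (use st tu in \<open>auto simp: cauchy_rel_iff MCauchy_closed nrm_nonneg nrm_minus_triangle\<close>)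
    with st tu show "(s, u) \<in> cauchy_rel V"
      by (simp add: cauchy_rel_iff)
  qed
qed

abbreviation cauchy_class :: "(nat \<Rightarrow> 'b) \<Rightarrow> (nat \<Rightarrow> 'b) set"
  where "cauchy_class s \<equiv> cauchy_rel V `` {s}"

lemma completion_carrier: "P \<in> carrier (completion V) \<longleftrightarrow> (\<exists>s. MCauchy s \<and> P = cauchy_class s)"
  by (auto simp: completion_def quotient_def)

lemma cauchy_class_eq: "(s, t) \<in> cauchy_rel V \<Longrightarrow> cauchy_class s = cauchy_class t"
  by (rule equiv_class_eq[OF equiv_cauchy_rel])

text \<open>The sum is defined as a union over all pairs of representatives; congruence collapses
  this union to a single class.\<close>

lemma completion_add:
  assumes "MCauchy s" "MCauchy t"
  shows "cauchy_class s \<oplus>\<^bsub>completion V\<^esub> cauchy_class t = cauchy_class (\<lambda>n. s n \<oplus> t n)"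
proof -
  have "congruent2 (cauchy_rel V) (cauchy_rel V) (\<lambda>s t. cauchy_class (\<lambda>n. s n \<oplus> t n))"
  proof (rule congruent2I', rule cauchy_class_eq)
    fix s s' t t' assume ss: "(s, s') \<in> cauchy_rel V" and tt: "(t, t') \<in> cauchy_rel V"
    have "(\<lambda>n. nrm V ((s n \<oplus> t n) \<ominus> (s' n \<oplus> t' n))) \<longlonglongrightarrow> 0"
      by (rule null_seq_le[of "\<lambda>n. nrm V (s n \<ominus> s' n)" "\<lambda>n. nrm V (t n \<ominus> t' n)"])
        (use ss tt in \<open>auto simp: cauchy_rel_iff MCauchy_closed minus_add_distrib nrm_triangle nrm_nonneg\<close>)
    with ss tt show "(\<lambda>n. s n \<oplus> t n, \<lambda>n. s' n \<oplus> t' n) \<in> cauchy_rel V"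
      by (simp add: cauchy_rel_iff MCauchy_add)
  qed
  from UN_equiv_class2[OF equiv_cauchy_rel equiv_cauchy_rel this] assms show ?thesis
    by (simp add: completion_def)
qed

lemma completion_scale:
  assumes "MCauchy s" "c \<in> K"
  shows "c \<odot>\<^bsub>completion V\<^esub> cauchy_class s = cauchy_class (\<lambda>n. c \<odot>\<^bsub>V\<^esub> s n)"
proof -
  have "congruent (cauchy_rel V) (\<lambda>s. cauchy_class (\<lambda>n. c \<odot>\<^bsub>V\<^esub> s n))"
  proof (rule congruentI, rule cauchy_class_eq)
    fix s t assume st: "(s, t) \<in> cauchy_rel V"
    have "(\<lambda>n. cmod c * nrm V (s n \<ominus> t n)) \<longlonglongrightarrow> cmod c * 0"
      using st unfolding cauchy_rel_iff by (intro tendsto_mult) auto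
    with st assms(2) show "(\<lambda>n. c \<odot>\<^bsub>V\<^esub> s n, \<lambda>n. c \<odot>\<^bsub>V\<^esub> t n) \<in> cauchy_rel V"
      by (simp add: cauchy_rel_iff MCauchy_scale nrm_smult MCauchy_closed flip: scale_minus_right)
  qed
  from UN_equiv_class[OF equiv_cauchy_rel this] assms show ?thesis
    by (simp add: completion_def)
qed

text \<open>The norm is defined by \<open>the_elem\<close>, so the image of the class must be a
  singleton: representatives differ by a null sequence, hence their norms have the same
  limit.\<close>

lemma completion_nrm:
  assumes "MCauchy s" and L: "(\<lambda>n. nrm V (s n)) \<longlonglongrightarrow> L"
  shows "nrm (completion V) (cauchy_class s) = L"
proof -
  have "lim (\<lambda>n. nrm V (t n)) = L" if "t \<in> cauchy_class s" for t
  proof (rule limI)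
    have "(t, s) \<in> cauchy_rel V"
      using that equiv_cauchy_rel by (auto elim: equivE symE)
    then show "(\<lambda>n. nrm V (t n)) \<longlonglongrightarrow> L"
      using L by (intro nrm_tendsto[of t s]) (auto simp: cauchy_rel_iff MCauchy_closed)
  qed
  moreover have "s \<in> cauchy_class s"
    using equiv_class_self[OF equiv_cauchy_rel] assms(1) by simp
  ultimately have "(\<lambda>t. lim (\<lambda>n. nrm V (t n))) ` cauchy_class s = {L}"
    by (intro antisym) (auto intro!: rev_image_eqI[of s])
  then show ?thesis
    by (simp add: completion_def)
qed

lemma completion_emb_eq: "completion_emb V v = cauchy_class (\<lambda>n. v)"
  by (simp add: completion_emb_def)

lemma completion_emb_closed: "v \<in> carrier V \<Longrightarrow> completion_emb V v \<in> carrier (completion V)"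
  by (auto simp: completion_carrier completion_emb_eq intro!: exI[of _ "\<lambda>n. v"])

lemma completion_emb_nrm: "v \<in> carrier V \<Longrightarrow> nrm (completion V) (completion_emb V v) = nrm V v"
  unfolding completion_emb_eq by (rule completion_nrm) auto

lemma completion_emb_linear: "linear_op K V (completion V) (completion_emb V)"
  by (auto simp: linear_op_def completion_emb_closed)
    (simp_all add: completion_emb_eq completion_add completion_scale)

text \<open>\<open>T\<close> is Lipschitz, so it maps Cauchy sequences to Cauchy sequences, which
  converge in the complete space \<open>W\<close>, and equivalent sequences to sequences with the
  same limit.\<close>

lemma extend_to_completion:
  assumes W: "banach_space K W" and T: "linear_op K V W T"
    and C: "\<And>v. v \<in> carrier V \<Longrightarrow> nrm W (T v) \<le> C * nrm V v"
  obtains U where "U \<in> ops K (completion V) W"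
    and "\<And>v. v \<in> carrier V \<Longrightarrow> U (completion_emb V v) = T v"
proof -
  interpret W: banach_space K W by fact
  note TD = linear_opD[OF T]
  have T_minus: "T (x \<ominus> y) = T x \<ominus>\<^bsub>W\<^esub> T y" if "x \<in> carrier V" "y \<in> carrier V" for x y
    using that by (simp add: a_minus_def TD uminus_scale W.uminus_scale)
  have T_conv: "\<exists>y. converges W (\<lambda>n. T (s n)) y" if s: "MCauchy s" for s
  proof -
    have "W.MCauchy (\<lambda>n. T (s n))"
      by (rule MCauchy_of_bound[OF s, of _ W C])
        (use s C in \<open>auto simp: MCauchy_closed TD W.normed_space_axioms simp flip: T_minus\<close>)
    then obtain y where y: "limitin W.mtopology (\<lambda>n. T (s n)) y sequentially"
      using W.complete unfolding W.mcomplete_def by blast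
    then have "y \<in> carrier W" "(\<lambda>n. ndist W (T (s n)) y) \<longlonglongrightarrow> 0"
      by (auto simp: W.limitin_metric_dist_null)
    then have "converges W (\<lambda>n. T (s n)) y"
      using s by (auto simp: converges_def ndist_def TD MCauchy_closed)
    then show ?thesis ..
  qed
  \<comment> \<open>Asking for a common limit along all representatives avoids choosing one; classes
    are nonempty, so that uniqueness of limits makes the description definite.\<close>
  define U where "U = (\<lambda>P\<in>carrier (completion V). THE y. \<forall>s\<in>P. converges W (\<lambda>n. T (s n)) y)"
  have U_class: "U (cauchy_class s) = y" if s: "MCauchy s" and y: "converges W (\<lambda>n. T (s n)) y" for s y
  proof -
    have self: "s \<in> cauchy_class s"
      using equiv_class_self[OF equiv_cauchy_rel] s by simp
    have "converges W (\<lambda>n. T (t n)) y" if "t \<in> cauchy_class s" for t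
    proof -
      from that have "(t, s) \<in> cauchy_rel V"
        using equiv_cauchy_rel by (auto elim: equivE symE)
      then have t: "MCauchy t" "(\<lambda>n. nrm V (t n \<ominus> s n)) \<longlonglongrightarrow> 0"
        by (auto simp: cauchy_rel_iff)
      have "(\<lambda>n. nrm W (T (t n) \<ominus>\<^bsub>W\<^esub> y)) \<longlonglongrightarrow> 0"
      proof (rule null_seq_le)
        show "(\<lambda>n. C * nrm V (t n \<ominus> s n)) \<longlonglongrightarrow> 0"
          using tendsto_mult_right_zero[OF t(2)] .
        show "(\<lambda>n. nrm W (T (s n) \<ominus>\<^bsub>W\<^esub> y)) \<longlonglongrightarrow> 0"
          using y by (simp add: converges_def)
        show "0 \<le> nrm W (T (t n) \<ominus>\<^bsub>W\<^esub> y)" for n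
          using t y by (simp add: W.nrm_nonneg MCauchy_closed TD converges_def)
        show "nrm W (T (t n) \<ominus>\<^bsub>W\<^esub> y) \<le>
            C * nrm V (t n \<ominus> s n) + nrm W (T (s n) \<ominus>\<^bsub>W\<^esub> y)" for n
          using W.nrm_minus_triangle[of "T (t n)" "T (s n)" y] C[of "t n \<ominus> s n"] s t y
          by (simp add: T_minus MCauchy_closed TD converges_def)
      qed
      then show ?thesis
        using t y by (auto simp: converges_def MCauchy_closed TD)
    qed
    then have "(THE y. \<forall>s\<in>cauchy_class s. converges W (\<lambda>n. T (s n)) y) = y"
      using self by (intro the_equality) (auto intro: W.converges_unique)
    then show ?thesis
      using s by (auto simp: U_def completion_carrier)
  qed
  have U_lim: "converges W (\<lambda>n. T (s n)) (U (cauchy_class s))" if "MCauchy s" for s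
    using T_conv[OF that] U_class[OF that] by blast
  show thesis
  proof (rule that)
    show "U (completion_emb V v) = T v" if "v \<in> carrier V" for v
      unfolding completion_emb_eq using that by (intro U_class) (auto simp: converges_def TD)
    have add: "U (P \<oplus>\<^bsub>completion V\<^esub> Q) = U P \<oplus>\<^bsub>W\<^esub> U Q"
      if P: "P \<in> carrier (completion V)" and Q: "Q \<in> carrier (completion V)" for P Q
    proof -
      obtain s t where s: "MCauchy s" "P = cauchy_class s" and t: "MCauchy t" "Q = cauchy_class t"
        using P Q by (auto simp: completion_carrier)
      have "converges W (\<lambda>n. T (s n \<oplus> t n)) (U P \<oplus>\<^bsub>W\<^esub> U Q)"
        using W.converges_add[OF U_lim[OF s(1)] U_lim[OF t(1)]]
        by (simp add: s t TD MCauchy_closed)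
      then show ?thesis
        using U_class[OF MCauchy_add[OF s(1) t(1)]] by (simp add: s t completion_add)
    qed
    have scale: "U (c \<odot>\<^bsub>completion V\<^esub> P) = c \<odot>\<^bsub>W\<^esub> U P"
      if c: "c \<in> K" and P: "P \<in> carrier (completion V)" for c P
    proof -
      obtain s where s: "MCauchy s" "P = cauchy_class s"
        using P by (auto simp: completion_carrier)
      have "converges W (\<lambda>n. T (c \<odot>\<^bsub>V\<^esub> s n)) (c \<odot>\<^bsub>W\<^esub> U P)"
        using W.converges_scale[OF U_lim[OF s(1)] c] by (simp add: s c TD MCauchy_closed)
      then show ?thesis
        using U_class[OF MCauchy_scale[OF s(1) c]] by (simp add: s c completion_scale)
    qed
    have bound: "nrm W (U P) \<le> C * nrm (completion V) P" if P: "P \<in> carrier (completion V)" for P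
    proof -
      obtain s where s: "MCauchy s" "P = cauchy_class s"
        using P by (auto simp: completion_carrier)
      obtain L where L: "(\<lambda>n. nrm V (s n)) \<longlonglongrightarrow> L"
        using convergent_nrm_MCauchy[OF s(1)] by (auto simp: convergent_def)
      have y: "converges W (\<lambda>n. T (s n)) (U P)"
        using U_lim[OF s(1)] s(2) by simp
      \<comment> \<open>The bound for \<open>U\<close> is the limit of the bounds for
        \<open>T\<close> along a representing sequence.\<close>
      have "(\<lambda>n. nrm W (T (s n))) \<longlonglongrightarrow> nrm W (U P)"
        by (rule W.nrm_tendsto[of _ "\<lambda>_. U P"]) (use y in \<open>simp_all add: converges_def\<close>)
      moreover have "(\<lambda>n. C * nrm V (s n)) \<longlonglongrightarrow> C * L"
        using L by (intro tendsto_intros)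
      ultimately have "nrm W (U P) \<le> C * L"
        by (rule LIMSEQ_le) (use C MCauchy_closed[OF s(1)] in blast)
      then show ?thesis
        using completion_nrm[OF s(1) L] s(2) by simp
    qed
    have "U P \<in> carrier W" if "P \<in> carrier (completion V)" for P
      using U_lim that by (auto simp: completion_carrier converges_def)
    moreover have "U \<in> extensional (carrier (completion V))"
      by (simp add: U_def)
    ultimately show "U \<in> ops K (completion V) W"
      using add scale bound unfolding mem_ops linear_op_def by blast
  qed
qed

end


section \<open>Tensor products\<close>

text \<open>A norming functional of the difference separates the points. The functionals range over
  all linear ones, bounded or not, because tensors are evaluated at all bilinear forms.\<close>

lemma (in normed_space) eq_of_linear_functionals:
  assumes "x \<in> carrier V" "y \<in> carrier V"
    and eq: "\<And>g. linear_op K V (scalar_space K) g \<Longrightarrow> g x = g y"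
  shows "x = y"
proof -
  obtain g where g: "linear_op K V (scalar_space K) g" and "g (x \<ominus> y) = of_real (nrm V (x \<ominus> y))"
    using norming_functional[of "x \<ominus> y"] assms(1,2) by auto
  moreover have "g (x \<ominus> y) = g x - g y"
    using linear_opD[OF g] assms(1,2) by (simp add: a_minus_def uminus_scale)
  ultimately show ?thesis
    using eq[OF g] assms(1,2) minus_eq_zero by (simp add: nrm_eq_zero_iff)
qed

lemma tensor_space_simps [simp]:
  "carrier (tensor_space K Z X N) = tensors K Z X" "zero (tensor_space K Z X N) = (\<lambda>B. 0)"
  "add (tensor_space K Z X N) = (\<lambda>u v B. u B + v B)"
  "smult (tensor_space K Z X N) = (\<lambda>c u B. c * u B)" "nrm (tensor_space K Z X N) = N"
  by (simp_all add: tensor_space_def)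

lemma tensor_sum_Nil [simp]: "tensor_sum K Z X [] = (\<lambda>B. 0)"
  by (simp add: tensor_sum_def)

lemma tensor_sum_Cons:
  "tensor_sum K Z X ((z, x) # ps) = (\<lambda>B. elem_tensor K Z X z x B + tensor_sum K Z X ps B)"
  by (simp add: tensor_sum_def)

lemma tensor_sum_append:
  "tensor_sum K Z X (ps @ qs) = (\<lambda>B. tensor_sum K Z X ps B + tensor_sum K Z X qs B)"
  by (simp add: tensor_sum_def)

lemma tensor_sum_apply:
  "B \<in> bilinear_forms K Z X \<Longrightarrow> tensor_sum K Z X ps B = (\<Sum>(z, x)\<leftarrow>ps. B z x)"
  by (simp add: tensor_sum_def elem_tensor_def)

lemma tensors_cases:
  assumes "u \<in> tensors K Z X"
  obtains ps where "set ps \<subseteq> carrier Z \<times> carrier X" "u = tensor_sum K Z X ps"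
  using assms by (auto simp: tensors_def)

lemma tensor_sum_in_tensors [intro]:
  "set ps \<subseteq> carrier Z \<times> carrier X \<Longrightarrow> tensor_sum K Z X ps \<in> tensors K Z X"
  by (auto simp: tensors_def)

lemma elem_tensor_eq_sum: "elem_tensor K Z X z x = tensor_sum K Z X [(z, x)]"
  by (simp add: tensor_sum_Cons)

lemma elem_tensor_in_tensors: "z \<in> carrier Z \<Longrightarrow> x \<in> carrier X \<Longrightarrow> elem_tensor K Z X z x \<in> tensors K Z X"
  unfolding elem_tensor_eq_sum by (rule tensor_sum_in_tensors) simp

lemma bilinear_forms_linear:
  assumes "B \<in> bilinear_forms K Z X"
  shows "z \<in> carrier Z \<Longrightarrow> linear_op K X (scalar_space K) (B z)"
    and "x \<in> carrier X \<Longrightarrow> linear_op K Z (scalar_space K) (\<lambda>z. B z x)"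
  using assms by (simp_all add: bilinear_forms_def)

lemma elem_tensor_bilinear:
  assumes "z \<in> carrier Z" "x \<in> carrier X"
  shows "z' \<in> carrier Z \<Longrightarrow> elem_tensor K Z X (z \<oplus>\<^bsub>Z\<^esub> z') x =
      (\<lambda>B. elem_tensor K Z X z x B + elem_tensor K Z X z' x B)"
    and "x' \<in> carrier X \<Longrightarrow> elem_tensor K Z X z (x \<oplus>\<^bsub>X\<^esub> x') =
      (\<lambda>B. elem_tensor K Z X z x B + elem_tensor K Z X z x' B)"
    and "c \<in> K \<Longrightarrow> elem_tensor K Z X (c \<odot>\<^bsub>Z\<^esub> z) x = (\<lambda>B. c * elem_tensor K Z X z x B)"
    and "c \<in> K \<Longrightarrow> elem_tensor K Z X z (c \<odot>\<^bsub>X\<^esub> x) = (\<lambda>B. c * elem_tensor K Z X z x B)"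
  using assms
  by (auto simp: elem_tensor_def linear_opD(2,3)[OF bilinear_forms_linear(1)]
      linear_opD(2,3)[OF bilinear_forms_linear(2)])

text \<open>One pair of spaces is treated at a time, with a single norm \<open>N\<close> in place of
  \<open>\<alpha> Z X\<close>. The assumption \<open>N_le\<close> later makes the projective norm
  definite.\<close>

locale tensor_product = Z: normed_space K Z + X: normed_space K X
  for K and Z :: "'z nspace" and X :: "'x nspace" +
  fixes N :: "('z, 'x) tensor \<Rightarrow> real"
  assumes normed: "normed_space K (tensor_space K Z X N)"
    and N_le: "u \<in> tensors K Z X \<Longrightarrow> N u \<le> projective_norm K Z X u"
begin

sublocale T: normed_space K "tensor_space K Z X N"
  by (fact normed)

section \<open>The projective norm and the operators bounded for it\<close>

abbreviation \<pi> :: "('z, 'x) tensor \<Rightarrow> real"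
  where "\<pi> \<equiv> projective_norm K Z X"

abbreviation cost :: "('z \<times> 'x) list \<Rightarrow> real"
  where "cost ps \<equiv> \<Sum>(z, x)\<leftarrow>ps. nrm Z z * nrm X x"

lemma cost_nonneg: "set ps \<subseteq> carrier Z \<times> carrier X \<Longrightarrow> 0 \<le> cost ps"
  by (induction ps) (auto simp: Z.nrm_nonneg X.nrm_nonneg)

lemma projective_le: "set ps \<subseteq> carrier Z \<times> carrier X \<Longrightarrow> \<pi> (tensor_sum K Z X ps) \<le> cost ps"
  unfolding projective_norm_def
  by (rule cInf_lower) (auto intro!: bdd_belowI[of _ 0] cost_nonneg)

lemma projective_greatest:
  assumes "u \<in> tensors K Z X"
    and "\<And>ps. set ps \<subseteq> carrier Z \<times> carrier X \<Longrightarrow> u = tensor_sum K Z X ps \<Longrightarrow> m \<le> cost ps"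
  shows "m \<le> \<pi> u"
  unfolding projective_norm_def
  using assms by (intro cInf_greatest) (auto simp: tensors_def)

lemma projective_nonneg: "u \<in> tensors K Z X \<Longrightarrow> 0 \<le> \<pi> u"
  by (rule projective_greatest) (auto intro: cost_nonneg)

lemma projective_elem_le:
  "z \<in> carrier Z \<Longrightarrow> x \<in> carrier X \<Longrightarrow> \<pi> (elem_tensor K Z X z x) \<le> nrm Z z * nrm X x"
  using projective_le[of "[(z, x)]"] by (simp add: elem_tensor_eq_sum)

text \<open>Concatenating representations adds their costs. The two infima are then taken one after
  the other, with the other cost moved to the left-hand side.\<close>

lemma projective_add:
  assumes u: "u \<in> tensors K Z X" and v: "v \<in> tensors K Z X"
  shows "\<pi> (\<lambda>B. u B + v B) \<le> \<pi> u + \<pi> v"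
proof -
  have "\<pi> (\<lambda>B. u B + v B) \<le> cost ps + cost qs"
    if "set ps \<subseteq> carrier Z \<times> carrier X" "u = tensor_sum K Z X ps"
      "set qs \<subseteq> carrier Z \<times> carrier X" "v = tensor_sum K Z X qs" for ps qs
    using projective_le[of "ps @ qs"] that by (simp add: tensor_sum_append)
  then have "\<pi> (\<lambda>B. u B + v B) - cost qs \<le> \<pi> u"
    if "set qs \<subseteq> carrier Z \<times> carrier X" "v = tensor_sum K Z X qs" for qs
    using that by (intro projective_greatest[OF u]) (simp add: algebra_simps)
  then have "\<pi> (\<lambda>B. u B + v B) - \<pi> u \<le> \<pi> v"
    by (intro projective_greatest[OF v]) (simp add: algebra_simps)
  then show ?thesis by simp
qed

lemma tensor_sum_scale:
  assumes "c \<in> K" "set ps \<subseteq> carrier Z \<times> carrier X"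
  shows "(\<lambda>B. c * tensor_sum K Z X ps B) = tensor_sum K Z X (map (\<lambda>(z, x). (c \<odot>\<^bsub>Z\<^esub> z, x)) ps)"
  using assms(2)
proof (induction ps)
  case (Cons p ps)
  obtain z x where "p = (z, x)" by fastforce
  with Cons assms(1) show ?case
    by (auto simp: tensor_sum_Cons elem_tensor_bilinear(3) algebra_simps fun_eq_iff)
qed simp

lemma projective_scale_le:
  assumes c: "c \<in> K" and u: "u \<in> tensors K Z X"
  shows "\<pi> (\<lambda>B. c * u B) \<le> cmod c * \<pi> u"
proof (cases "c = 0")
  case True
  then show ?thesis
    using projective_le[of "[]"] by simp
next
  case False
  have "\<pi> (\<lambda>B. c * u B) / cmod c \<le> \<pi> u"
  proof (rule projective_greatest[OF u])
    fix ps assume ps: "set ps \<subseteq> carrier Z \<times> carrier X" "u = tensor_sum K Z X ps"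
    let ?qs = "map (\<lambda>(z, x). (c \<odot>\<^bsub>Z\<^esub> z, x)) ps"
    have "set ?qs \<subseteq> carrier Z \<times> carrier X"
      using ps c by auto
    then have "\<pi> (\<lambda>B. c * u B) \<le> cost ?qs"
      using projective_le[of ?qs] tensor_sum_scale[OF c ps(1)] ps(2) by simp
    also have "cost ?qs = cmod c * cost ps"
      using ps(1) c by (induction ps) (auto simp: Z.nrm_smult algebra_simps)
    finally show "\<pi> (\<lambda>B. c * u B) / cmod c \<le> cost ps"
      using False by (simp add: field_simps)
  qed
  then show ?thesis
    using False by (simp add: field_simps)
qed

text \<open>The module structure is that of the space normed by \<open>N\<close>, as only the field
  \<open>nrm\<close> differs. Definiteness comes from \<open>N u \<le> \<pi> u\<close>, and
  homogeneity from \<open>projective_scale_le\<close> for both \<open>c\<close> and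
  \<open>inverse c\<close>.\<close>

lemma normed_projective: "normed_space K (tensor_space K Z X \<pi>)"
proof -
  have eq: "tensor_space K Z X \<pi> = (tensor_space K Z X N)\<lparr>nrm := \<pi>\<rparr>"
    by (simp add: tensor_space_def)
  have "module (scalar_ring K) (tensor_space K Z X \<pi>)"
    using T.module_axioms unfolding eq
    by (simp add: module_def module_axioms_def abelian_group_def abelian_monoid_def
        abelian_group_axioms_def)
  moreover have "normed_space_axioms K (tensor_space K Z X \<pi>)"
  proof
    show "K = \<real> \<or> K = UNIV"
      by (rule Z.scalar_field)
    fix u assume u: "u \<in> carrier (tensor_space K Z X \<pi>)"
    then show "0 \<le> nrm (tensor_space K Z X \<pi>) u"
      by (simp add: projective_nonneg)
    have "\<pi> (\<lambda>B. 0) \<le> 0"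
      using projective_le[of "[]"] by simp
    moreover have "N u \<le> \<pi> u" "0 \<le> N u" "0 \<le> \<pi> u" "N u = 0 \<longleftrightarrow> u = (\<lambda>B. 0)"
      using u N_le T.nrm_nonneg[of u] T.nrm_eq_zero_iff[of u] by (simp_all add: projective_nonneg)
    ultimately show "nrm (tensor_space K Z X \<pi>) u = 0 \<longleftrightarrow> u = \<zero>\<^bsub>tensor_space K Z X \<pi>\<^esub>"
      by auto
    show "nrm (tensor_space K Z X \<pi>) (u \<oplus>\<^bsub>tensor_space K Z X \<pi>\<^esub> v) \<le>
        nrm (tensor_space K Z X \<pi>) u + nrm (tensor_space K Z X \<pi>) v"
      if "v \<in> carrier (tensor_space K Z X \<pi>)" for v
      using u that by (simp add: projective_add)
    show "nrm (tensor_space K Z X \<pi>) (c \<odot>\<^bsub>tensor_space K Z X \<pi>\<^esub> u) =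
        cmod c * nrm (tensor_space K Z X \<pi>) u" if c: "c \<in> K" for c
    proof (cases "c = 0")
      case True
      have "\<pi> (\<lambda>B. 0) = 0"
        using projective_le[of "[]"] projective_nonneg[of "\<lambda>B. 0"] T.M.zero_closed by simp
      with True show ?thesis by simp
    next
      case False
      have cu: "(\<lambda>B. c * u B) \<in> tensors K Z X"
        using T.scale_closed[OF c, of u] u by simp
      have "\<pi> (\<lambda>B. inverse c * (c * u B)) \<le> cmod (inverse c) * \<pi> (\<lambda>B. c * u B)"
        using projective_scale_le[OF _ cu, of "inverse c"] c by simp
      moreover have "(\<lambda>B. inverse c * (c * u B)) = u"
        using False by (simp add: fun_eq_iff)
      ultimately have "cmod c * \<pi> u \<le> \<pi> (\<lambda>B. c * u B)"
        using False by (simp add: norm_inverse norm_divide field_simps)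
      with projective_scale_le[OF c, of u] u show ?thesis
        by simp
    qed
  qed
  ultimately show ?thesis
    by (rule normed_space.intro)
qed

text \<open>
  The value of the lift at \<open>u\<close> is pinned down by \<open>g (T u) = u (g \<circ> S)\<close> for all linear functionals
  \<open>g\<close> on the codomain; this makes it independent of the representation of \<open>u\<close>.
\<close>

lemma tensor_lift:
  assumes Y: "normed_space K Y" and S: "bilinear_op K Z X Y S" and "0 < C"
    and C: "\<And>z x. z \<in> carrier Z \<Longrightarrow> x \<in> carrier X \<Longrightarrow> nrm Y (S z x) \<le> C * (nrm Z z * nrm X x)"
  obtains T where "linear_op K (tensor_space K Z X N) Y T"
    and "\<And>z x. z \<in> carrier Z \<Longrightarrow> x \<in> carrier X \<Longrightarrow> T (elem_tensor K Z X z x) = S z x"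
    and "\<And>u. u \<in> tensors K Z X \<Longrightarrow> nrm Y (T u) \<le> C * \<pi> u"
proof -
  interpret Y: normed_space K Y by fact
  let ?S = "\<lambda>g z x. g (S z x)"
  define G where "G = {g. linear_op K Y (scalar_space K) g}"
  define lifts where "lifts u y \<longleftrightarrow> y \<in> carrier Y \<and> (\<forall>g\<in>G. g y = u (?S g))" for u :: "('z, 'x) tensor" and y
  have linz: "linear_op K X Y (S z)" if "z \<in> carrier Z" for z
    using S that by (simp add: bilinear_op_def)
  have linx: "linear_op K Z Y (\<lambda>z. S z x)" if "x \<in> carrier X" for x
    using S that by (simp add: bilinear_op_def)
  have S_closed: "S z x \<in> carrier Y" if "z \<in> carrier Z" "x \<in> carrier X" for z x
    using linear_opD(1)[OF linz] that by simp
  have form: "?S g \<in> bilinear_forms K Z X" if "g \<in> G" for g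
    using that linear_opD[OF linz] linear_opD[OF linx]
    by (auto simp: G_def bilinear_forms_def linear_op_def)
  have unique: "y = y'" if "lifts u y" "lifts u y'" for u y y'
    using that by (intro Y.eq_of_linear_functionals) (auto simp: lifts_def G_def)
  \<comment> \<open>Existence and bound are proved together for one list. As the lifted value
    depends only on the tensor, the bound then holds with the cost of every representation, hence
    with \<open>\<pi>\<close>.\<close>
  have sum: "\<exists>y. lifts (tensor_sum K Z X ps) y \<and> nrm Y y \<le> C * cost ps"
    if "set ps \<subseteq> carrier Z \<times> carrier X" for ps
    using that
  proof (induction ps)
    case Nil
    have "g \<zero>\<^bsub>Y\<^esub> = 0" if "g \<in> G" for g
      using that linear_opD(3)[of K Y "scalar_space K" g 0 "\<zero>\<^bsub>Y\<^esub>"] by (simp add: G_def)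
    then show ?case
      by (intro exI[of _ "\<zero>\<^bsub>Y\<^esub>"]) (simp add: lifts_def)
  next
    case (Cons p ps)
    then obtain z x where p: "p = (z, x)" "z \<in> carrier Z" "x \<in> carrier X"
      by auto
    obtain y where y: "lifts (tensor_sum K Z X ps) y" "nrm Y y \<le> C * cost ps"
      using Cons by auto
    have "lifts (tensor_sum K Z X (p # ps)) (S z x \<oplus>\<^bsub>Y\<^esub> y)"
      using y(1) p S_closed form
      by (auto simp: lifts_def G_def tensor_sum_Cons elem_tensor_def linear_opD(2))
    moreover have "nrm Y (S z x \<oplus>\<^bsub>Y\<^esub> y) \<le> C * cost (p # ps)"
      using Y.nrm_triangle[of "S z x" y] C[of z x] y p S_closed[of z x]
      by (simp add: lifts_def algebra_simps)
    ultimately show ?case by blast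
  qed
  define T where "T u = (THE y. lifts u y)" for u
  have T_eq: "T u = y" if "lifts u y" for u y
    unfolding T_def using that unique by (intro the_equality) auto
  have lifts_T: "lifts u (T u)" if u: "u \<in> tensors K Z X" for u
  proof -
    obtain y where "lifts u y"
      using u sum unfolding tensors_def by blast
    then show ?thesis
      using T_eq by metis
  qed
  show thesis
  proof (rule that)
    have "lifts (\<lambda>B. u B + v B) (T u \<oplus>\<^bsub>Y\<^esub> T v)" if "u \<in> tensors K Z X" "v \<in> tensors K Z X" for u v
      using lifts_T[OF that(1)] lifts_T[OF that(2)] by (auto simp: lifts_def G_def linear_opD(2))
    moreover have "lifts (\<lambda>B. c * u B) (c \<odot>\<^bsub>Y\<^esub> T u)" if "u \<in> tensors K Z X" "c \<in> K" for u c
      using lifts_T[OF that(1)] that(2) by (auto simp: lifts_def G_def linear_opD(3))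
    ultimately show "linear_op K (tensor_space K Z X N) Y T"
      using lifts_T T_eq by (auto simp: linear_op_def lifts_def)
    show "T (elem_tensor K Z X z x) = S z x" if "z \<in> carrier Z" "x \<in> carrier X" for z x
      using that form S_closed by (intro T_eq) (auto simp: lifts_def elem_tensor_def)
    show "nrm Y (T u) \<le> C * \<pi> u" if u: "u \<in> tensors K Z X" for u
    proof -
      have "nrm Y (T u) / C \<le> \<pi> u"
      proof (rule projective_greatest[OF u])
        fix ps assume ps: "set ps \<subseteq> carrier Z \<times> carrier X" "u = tensor_sum K Z X ps"
        then have "nrm Y (T u) \<le> C * cost ps"
          using sum[OF ps(1)] T_eq by auto
        then show "nrm Y (T u) / C \<le> cost ps"
          using \<open>0 < C\<close> by (simp add: field_simps)
      qed
      then show ?thesis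
        using \<open>0 < C\<close> by (simp add: field_simps)
    qed
  qed
qed

lemma projective_bound:
  assumes A: "A \<in> bilinear_forms K Z X" and "0 \<le> C"
    and C: "\<And>z x. z \<in> carrier Z \<Longrightarrow> x \<in> carrier X \<Longrightarrow> cmod (A z x) \<le> C * (nrm Z z * nrm X x)"
    and u: "u \<in> tensors K Z X"
  shows "cmod (u A) \<le> C * \<pi> u"
proof -
  have bound: "cmod (u A) \<le> C * cost ps"
    if "set ps \<subseteq> carrier Z \<times> carrier X" "u = tensor_sum K Z X ps" for ps
  proof -
    have "cmod (\<Sum>(z, x)\<leftarrow>ps. A z x) \<le> C * cost ps"
      using that(1)
    proof (induction ps)
      case (Cons p ps)
      then show ?case
        using C norm_triangle_le[of "case p of (z, x) \<Rightarrow> A z x" "\<Sum>(z, x)\<leftarrow>ps. A z x"]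
        by (fastforce simp: distrib_left intro: norm_triangle_le add_mono)
    qed simp
    then show ?thesis
      using that(2) by (simp add: tensor_sum_apply[OF A])
  qed
  show ?thesis
  proof (cases "C = 0")
    \<comment> \<open>Division by \<open>C\<close> is impossible here; a single representation
      already gives \<open>u A = 0\<close>.\<close>
    case True
    obtain ps where "set ps \<subseteq> carrier Z \<times> carrier X" "u = tensor_sum K Z X ps"
      using u by (rule tensors_cases)
    with bound True show ?thesis by auto
  next
    case False
    with \<open>0 \<le> C\<close> have "0 < C" by simp
    have "cmod (u A) / C \<le> \<pi> u"
      using bound \<open>0 < C\<close> by (intro projective_greatest[OF u]) (simp add: field_simps)
    then show ?thesis
      using \<open>0 < C\<close> by (simp add: field_simps)
  qed
qed

text \<open>A norming functional \<open>f\<close> on the tensors, taken with the norm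
  \<open>\<pi>\<close> and not \<open>N\<close>, is read as the form
  \<open>f (z \<otimes> x)\<close>. This form has bound 1 because elementary tensors cost at most
  the product of the norms.\<close>

lemma projective_norming_form:
  assumes u: "u \<in> tensors K Z X"
  obtains A where "A \<in> bilinear_forms K Z X"
    and "\<And>z x. z \<in> carrier Z \<Longrightarrow> x \<in> carrier X \<Longrightarrow> cmod (A z x) \<le> nrm Z z * nrm X x"
    and "u A = of_real (\<pi> u)"
proof -
  interpret P: normed_space K "tensor_space K Z X \<pi>"
    by (rule normed_projective)
  obtain f where f: "linear_op K (tensor_space K Z X \<pi>) (scalar_space K) f"
    and le: "\<And>v. v \<in> tensors K Z X \<Longrightarrow> cmod (f v) \<le> \<pi> v" and fu: "f u = of_real (\<pi> u)"
    using P.norming_functional[of u] u by auto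
  note fD = linear_opD[OF f, simplified]
  define A where "A z x = f (elem_tensor K Z X z x)" for z x
  have A: "A \<in> bilinear_forms K Z X"
    by (auto simp: bilinear_forms_def linear_op_def A_def elem_tensor_in_tensors
        elem_tensor_bilinear fD)
  have f_sum: "f (tensor_sum K Z X ps) = tensor_sum K Z X ps A"
    if "set ps \<subseteq> carrier Z \<times> carrier X" for ps
    using that
  proof (induction ps)
    case Nil
    then show ?case
      using fD(3)[of 0 "\<lambda>B. 0"] P.M.zero_closed by simp
  next
    case (Cons p ps)
    obtain z x where "p = (z, x)" by fastforce
    with Cons A show ?case
      by (auto simp: tensor_sum_Cons fD(2) elem_tensor_in_tensors tensor_sum_in_tensors)
        (simp add: elem_tensor_def A_def)
  qed
  then have "u A = of_real (\<pi> u)"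
    using u fu by (auto simp: tensors_def)
  moreover have "cmod (A z x) \<le> nrm Z z * nrm X x" if "z \<in> carrier Z" "x \<in> carrier X" for z x
    unfolding A_def
    using le[OF elem_tensor_in_tensors[OF that]] projective_elem_le[OF that] by (rule order_trans)
  ultimately show thesis
    by (intro that[OF A])
qed

end


section \<open>Uniform boundedness\<close>

context tensor_product
begin

text \<open>A tensor is a finite sum of evaluations at points of the carriers, so it sees a form
  only there. With \<open>c = 0\<close> this also shows that forms agreeing on the carriers have
  equal values at \<open>u\<close>.\<close>

lemma tensor_form_linear:
  assumes u: "u \<in> tensors K Z X"
    and forms: "B \<in> bilinear_forms K Z X" "B' \<in> bilinear_forms K Z X" "B'' \<in> bilinear_forms K Z X"
    and eq: "\<And>z x. z \<in> carrier Z \<Longrightarrow> x \<in> carrier X \<Longrightarrow> B'' z x = B z x + c * B' z x"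
  shows "u B'' = u B + c * u B'"
proof -
  obtain ps where ps: "set ps \<subseteq> carrier Z \<times> carrier X" "u = tensor_sum K Z X ps"
    using u by (rule tensors_cases)
  from ps(1) have "(\<Sum>(z, x)\<leftarrow>ps. B'' z x) = (\<Sum>(z, x)\<leftarrow>ps. B z x) + c * (\<Sum>(z, x)\<leftarrow>ps. B' z x)"
    by (induction ps) (auto simp: eq algebra_simps)
  then show ?thesis
    by (simp add: ps(2) tensor_sum_apply forms)
qed

lemma bilinear_forms_add_scale:
  assumes "B \<in> bilinear_forms K Z X" "B' \<in> bilinear_forms K Z X" "c \<in> K"
  shows "(\<lambda>z x. B z x + c * B' z x) \<in> bilinear_forms K Z X"
  using assms linear_opD[OF bilinear_forms_linear(1)[OF assms(1)]]
    linear_opD[OF bilinear_forms_linear(2)[OF assms(1)]]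
    linear_opD[OF bilinear_forms_linear(1)[OF assms(2)]]
    linear_opD[OF bilinear_forms_linear(2)[OF assms(2)]]
  by (simp add: bilinear_forms_def linear_op_def algebra_simps)

lemma closed_scalars: "closed K"
  using Z.scalar_field closed_complex_Reals by auto

text \<open>The terms are dominated by a geometric series with ratio 1/3 and sum 3/2. The factor
  \<open>r\<close> allows the same lemma to serve for the whole series and for its tails.\<close>

lemma bilinear_forms_series:
  fixes A :: "nat \<Rightarrow> 'z \<Rightarrow> 'x \<Rightarrow> complex" and c :: "nat \<Rightarrow> real"
  assumes A: "\<And>k. A k \<in> bilinear_forms K Z X"
    and A_le: "\<And>k z x. z \<in> carrier Z \<Longrightarrow> x \<in> carrier X \<Longrightarrow> cmod (A k z x) \<le> nrm Z z * nrm X x"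
    and c: "\<And>k. \<bar>c k\<bar> \<le> r * (1/3) ^ k"
  shows "z \<in> carrier Z \<Longrightarrow> x \<in> carrier X \<Longrightarrow> summable (\<lambda>k. c k * A k z x)"
    and "z \<in> carrier Z \<Longrightarrow> x \<in> carrier X \<Longrightarrow>
      cmod (\<Sum>k. c k * A k z x) \<le> r * (3/2) * (nrm Z z * nrm X x)"
    and "(\<lambda>z x. \<Sum>k. c k * A k z x) \<in> bilinear_forms K Z X"
proof -
  have geo: "(\<lambda>k. r * (1/3) ^ k * m) sums (r * (3/2) * m)" for m :: real
    using sums_mult2[OF sums_mult[OF geometric_sums[of "1/3 :: real"], of r], of m] by simp
  have le: "cmod (c k * A k z x) \<le> r * (1/3) ^ k * (nrm Z z * nrm X x)"
    if "z \<in> carrier Z" "x \<in> carrier X" for k z x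
    using mult_mono[OF c A_le[OF that]] c[of k]
    by (simp add: norm_mult abs_le_iff)
  show sm: "summable (\<lambda>k. c k * A k z x)" if "z \<in> carrier Z" "x \<in> carrier X" for z x
    by (rule summable_comparison_test'[OF sums_summable[OF geo] le[OF that]])
  show "cmod (\<Sum>k. c k * A k z x) \<le> r * (3/2) * (nrm Z z * nrm X x)"
    if "z \<in> carrier Z" "x \<in> carrier X" for z x
  proof -
    let ?g = "\<lambda>k. r * (1/3) ^ k * (nrm Z z * nrm X x)"
    have "norm (cmod (c k * A k z x)) \<le> ?g k" for k
      using le[OF that] by (simp only: real_norm_def abs_norm_cancel)
    then have norm_sm: "summable (\<lambda>k. cmod (c k * A k z x))"
      by (rule summable_comparison_test'[OF sums_summable[OF geo]])
    then have "cmod (\<Sum>k. c k * A k z x) \<le> (\<Sum>k. cmod (c k * A k z x))"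
      by (rule summable_norm)
    also have "\<dots> \<le> (\<Sum>k. ?g k)"
      by (rule suminf_le[OF le[OF that] norm_sm sums_summable[OF geo]])
    finally show ?thesis
      unfolding sums_unique[OF geo, symmetric] .
  qed
  \<comment> \<open>The sum is formed in the complex numbers; for real scalars it stays real because
    the reals are closed.\<close>
  have mem: "(\<Sum>k. c k * A k z x) \<in> K" if z: "z \<in> carrier Z" and x: "x \<in> carrier X" for z x
  proof (rule closed_sequentially[OF closed_scalars])
    show "(\<lambda>n. \<Sum>k<n. c k * A k z x) \<longlonglongrightarrow> (\<Sum>k. c k * A k z x)"
      using sm[OF z x] by (rule summable_LIMSEQ)
    have "c k * A k z x \<in> K" for k
      using linear_opD(1)[OF bilinear_forms_linear(1)[OF A z] x, of k] by simp
    then show "(\<Sum>k<n. c k * A k z x) \<in> K" for n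
      by (induction n) auto
  qed
  note lin1 = linear_opD(2,3)[OF bilinear_forms_linear(1)[OF A], simplified]
  note lin2 = linear_opD(2,3)[OF bilinear_forms_linear(2)[OF A], simplified]
  show "(\<lambda>z x. \<Sum>k. c k * A k z x) \<in> bilinear_forms K Z X"
    unfolding bilinear_forms_def linear_op_def
    by (auto simp: mem lin1 lin2 sm suminf_add suminf_mult[symmetric] algebra_simps)
qed

text \<open>
  Gliding hump: were the claim false, one could pick tensors \<open>u n\<close> with \<open>\<pi> (u n) > 4 ^ n * N (u n)\<close>
  and norming forms \<open>A n\<close>, and choose the signs in \<open>F = (\<Sum>n. \<plusminus> A n / 3 ^ n)\<close> one after the other such
  that the first \<open>n + 1\<close> terms together have modulus at least \<open>\<pi> (u n) / 3 ^ n\<close> at \<open>u n\<close>. The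
  remaining terms contribute at most half of that, so \<open>F\<close> is not \<open>N\<close>-bounded.
\<close>

theorem projective_le_of_bounded_forms:
  assumes bounded: "\<And>F. F \<in> bilinear_forms K Z X \<Longrightarrow>
      \<exists>C. \<forall>z\<in>carrier Z. \<forall>x\<in>carrier X. cmod (F z x) \<le> C * (nrm Z z * nrm X x) \<Longrightarrow>
      \<exists>C. \<forall>u\<in>tensors K Z X. cmod (u F) \<le> C * N u"
  shows "\<exists>C>0. \<forall>u\<in>tensors K Z X. \<pi> u \<le> C * N u"
proof (rule ccontr)
  assume contra: "\<not> ?thesis"
  have "\<exists>u. u \<in> tensors K Z X \<and> 4 ^ n * N u < \<pi> u" for n :: nat
  proof -
    have "(0 :: real) < 4 ^ n" by simp
    then have "\<not> (\<forall>u\<in>tensors K Z X. \<pi> u \<le> 4 ^ n * N u)"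
      using contra by blast
    then show ?thesis
      by (auto simp: not_le)
  qed
  then obtain u where u: "\<And>n. u n \<in> tensors K Z X" and u_gt: "\<And>n :: nat. 4 ^ n * N (u n) < \<pi> (u n)"
    by metis
  have "\<exists>A. A \<in> bilinear_forms K Z X \<and>
      (\<forall>z\<in>carrier Z. \<forall>x\<in>carrier X. cmod (A z x) \<le> nrm Z z * nrm X x) \<and> u n A = of_real (\<pi> (u n))" for n
    using projective_norming_form[OF u] by metis
  then obtain A where A: "\<And>n. A n \<in> bilinear_forms K Z X"
    and A_le: "\<And>n z x. z \<in> carrier Z \<Longrightarrow> x \<in> carrier X \<Longrightarrow> cmod (A n z x) \<le> nrm Z z * nrm X x"
    and uA: "\<And>n. u n (A n) = of_real (\<pi> (u n))"
    by metis
  \<comment> \<open>A tensor with \<open>N (u n) = 0\<close> would be zero, and the strict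
    inequality \<open>u_gt\<close> would fail. Positivity allows \<open>N (u n)\<close> to be
    cancelled at the end.\<close>
  have N_pos: "0 < N (u n)" for n
  proof -
    have "\<pi> (\<lambda>B. 0) \<le> 0"
      using projective_le[of "[]"] by simp
    moreover have "0 \<le> N (u n)" "N (u n) = 0 \<longleftrightarrow> u n = (\<lambda>B. 0)"
      using T.nrm_nonneg[of "u n"] T.nrm_eq_zero_iff[of "u n"] u by simp_all
    ultimately show ?thesis
      using u_gt[of n] by fastforce
  qed
  define s where "s n B = (if \<pi> (u n) / 3 ^ n \<le> cmod (u n B + of_real (\<pi> (u n) / 3 ^ n))
    then 1 / 3 ^ n else - (1 / 3 ^ n) :: real)" for n B
  \<comment> \<open>\<open>P n\<close> collects the terms with index below \<open>n\<close>. The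
    recursion runs on the partial sums themselves, as the sign of the next term depends on
    them.\<close>
  define P where "P = rec_nat (\<lambda>z x. 0) (\<lambda>n B z x. B z x + of_real (s n B) * A n z x)"
  define c where "c n = s n (P n)" for n
  have P_0: "P 0 = (\<lambda>z x. 0)" and P_Suc: "P (Suc n) = (\<lambda>z x. P n z x + of_real (c n) * A n z x)" for n
    by (simp_all add: P_def c_def)
  have c: "\<bar>c n\<bar> = (1/3) ^ n" for n
    by (simp add: c_def s_def power_divide)
  have P_form: "P n \<in> bilinear_forms K Z X" for n
  proof (induction n)
    case 0
    show ?case by (simp add: P_0 bilinear_forms_def linear_op_def)
  next
    case (Suc n)
    then show ?case
      unfolding P_Suc by (intro bilinear_forms_add_scale A) simp_all
  qed
  have P_sum: "P n z x = (\<Sum>k<n. c k * A k z x)" for n z x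
    by (induction n) (simp_all add: P_0 P_Suc)
  have hump: "\<pi> (u n) / 3 ^ n \<le> cmod (u n (P (Suc n)))" for n
  proof -
    define a where "a = u n (P n)"
    define b where "b = complex_of_real (\<pi> (u n) / 3 ^ n)"
    have b: "cmod b = \<pi> (u n) / 3 ^ n"
      unfolding b_def norm_of_real using projective_nonneg[OF u, of n] by simp
    have "u n (P (Suc n)) = a + of_real (c n) * of_real (\<pi> (u n))"
      using tensor_form_linear[OF u P_form A P_form, of "Suc n" n "of_real (c n)" n n]
      by (simp add: P_Suc uA a_def)
    then have "u n (P (Suc n)) = (if cmod b \<le> cmod (a + b) then a + b else a - b)"
      by (simp add: c_def s_def a_def b b_def[symmetric]) (simp add: b_def)
    \<comment> \<open>The difference of \<open>a + b\<close> and \<open>a - b\<close> has modulus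
      \<open>2 * cmod b\<close>, so they cannot both be smaller than \<open>b\<close>.\<close>
    moreover have "cmod b \<le> cmod (a - b)" if "\<not> cmod b \<le> cmod (a + b)"
      using that norm_triangle_ineq4[of "a + b" "a - b"] by (simp flip: mult_2)
    ultimately show ?thesis
      by (simp add: b)
  qed
  define F where "F z x = (\<Sum>k. of_real (c k) * A k z x)" for z x
  have F: "F \<in> bilinear_forms K Z X"
    and F_le: "z \<in> carrier Z \<Longrightarrow> x \<in> carrier X \<Longrightarrow> cmod (F z x) \<le> 3/2 * (nrm Z z * nrm X x)"
    and F_summable: "z \<in> carrier Z \<Longrightarrow> x \<in> carrier X \<Longrightarrow> summable (\<lambda>k. c k * A k z x)" for z x
    unfolding F_def using bilinear_forms_series[where A = A and c = c and r = 1, OF A A_le] c by auto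
  obtain C where C: "\<And>u. u \<in> tensors K Z X \<Longrightarrow> cmod (u F) \<le> C * N u"
    using bounded[OF F] F_le by blast
  have lower: "\<pi> (u n) / 3 ^ n / 2 \<le> cmod (u n F)" for n
  proof -
    define D where "D z x = (\<Sum>k. of_real (c (k + Suc n)) * A (k + Suc n) z x)" for z x
    \<comment> \<open>The tail starts right after the hump, whence \<open>r = (1/3) ^ Suc n\<close>;
      the factor 3/2 then leaves exactly half of \<open>(1/3) ^ n\<close>.\<close>
    have "\<bar>c (k + Suc n)\<bar> \<le> (1/3) ^ Suc n * (1/3) ^ k" for k
      by (simp add: c power_add mult.commute)
    note series = bilinear_forms_series[where A = "\<lambda>k. A (k + Suc n)" and c = "\<lambda>k. c (k + Suc n)",
        OF A A_le this]
    have D: "D \<in> bilinear_forms K Z X"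
      unfolding D_def by (rule series(3)) 
    have D_le: "cmod (D z x) \<le> (1/3) ^ Suc n * (3/2) * (nrm Z z * nrm X x)"
      if "z \<in> carrier Z" "x \<in> carrier X" for z x
      unfolding D_def by (rule series(2)) (use that in auto)
    \<comment> \<open>The factor 1 matches the shape of \<open>tensor_form_linear\<close>.\<close>
    have "F z x = P (Suc n) z x + 1 * D z x" if "z \<in> carrier Z" "x \<in> carrier X" for z x
      unfolding F_def D_def P_sum
      using suminf_split_initial_segment[OF F_summable[OF that], of "Suc n"] by simp
    then have "u n F = u n (P (Suc n)) + u n D"
      using tensor_form_linear[OF u P_form D F, of "Suc n" 1 n] by simp
    moreover have "cmod (u n D) \<le> (1/3) ^ Suc n * (3/2) * \<pi> (u n)"
      by (rule projective_bound[OF D _ D_le u]) auto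
    moreover have "(1/3) ^ Suc n * (3/2) * \<pi> (u n) = \<pi> (u n) / 3 ^ n / 2"
      by (simp add: power_divide)
    ultimately show ?thesis
      using hump[of n] norm_diff_ineq[of "u n (P (Suc n))" "u n D"] by simp
  qed
  \<comment> \<open>The defect \<open>4 ^ n\<close> meets the weight \<open>1 / 3 ^ n\<close>, and
    the 2 is the half lost to the tail.\<close>
  have "(4/3) ^ n \<le> 2 * C" for n :: nat
  proof -
    have "4 ^ n * N (u n) / 3 ^ n / 2 \<le> \<pi> (u n) / 3 ^ n / 2"
      using u_gt[of n] by (intro divide_right_mono) auto
    also have "\<dots> \<le> C * N (u n)"
      using lower[of n] C[OF u[of n]] by simp
    finally show ?thesis
      using N_pos[of n] by (simp add: field_simps)
  qed
  moreover obtain n where "2 * C < (4/3) ^ n"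
    using real_arch_pow[of "4/3" "2 * C"] by auto
  ultimately show False
    by (meson not_le)
qed

end


section \<open>The scalar field as a Banach space\<close>

context normed_space
begin

lemma banach_spaceI:
  assumes "\<And>s. MCauchy s \<Longrightarrow> \<exists>y\<in>carrier V. (\<lambda>n. nrm V (s n \<ominus> y)) \<longlonglongrightarrow> 0"
  shows "banach_space K V"
proof
  show mcomplete
    unfolding mcomplete_def
  proof (intro allI impI)
    fix s assume s: "MCauchy s"
    then obtain y where "y \<in> carrier V" "(\<lambda>n. nrm V (s n \<ominus> y)) \<longlonglongrightarrow> 0"
      using assms by blast
    then have "limitin mtopology s y sequentially"
      using s by (simp add: limitin_metric_dist_null ndist_def MCauchy_closed)
    then show "\<exists>y. limitin mtopology s y sequentially" ..
  qed
qed

lemma normed_scalar_space: "normed_space K (scalar_space K)"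
proof (intro normed_space.intro moduleI)
  show "cring (scalar_ring K)"
    by (rule R.is_cring)
  show "abelian_group (scalar_space K)"
  proof (rule abelian_groupI)
    show "\<exists>y\<in>carrier (scalar_space K). y \<oplus>\<^bsub>scalar_space K\<^esub> x = \<zero>\<^bsub>scalar_space K\<^esub>"
      if "x \<in> carrier (scalar_space K)" for x
      using that by (intro bexI[of _ "- x"]) auto
  qed auto
  show "normed_space_axioms K (scalar_space K)"
    by unfold_locales (auto simp: norm_triangle_ineq norm_mult scalar_field)
qed (auto simp: algebra_simps)

text \<open>Cauchy sequences converge in the complex numbers, and the limit stays in
  \<open>K\<close> because \<open>K\<close> is closed.\<close>

lemma banach_scalar_space: "banach_space K (scalar_space K)"
proof -
  interpret S: normed_space K "scalar_space K"
    by (rule normed_scalar_space)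
  have minus: "x \<ominus>\<^bsub>scalar_space K\<^esub> y = x - y" if "y \<in> K" for x y
    using that by (simp add: a_minus_def S.uminus_scale)
  have "closed K"
    using scalar_field closed_complex_Reals by auto
  show ?thesis
  proof (rule S.banach_spaceI)
    fix s assume s: "S.MCauchy s"
    then have mem: "s n \<in> K" for n
      using S.MCauchy_closed by simp
    have "Cauchy s"
      using s mem unfolding S.MCauchy_iff Cauchy_iff by (auto simp: minus)
    then obtain y where y: "s \<longlonglongrightarrow> y"
      by (auto simp: Cauchy_convergent_iff convergent_def)
    then have "y \<in> K"
      using \<open>closed K\<close> mem by (rule closed_sequentially[rotated 2])
    with y show "\<exists>y\<in>carrier (scalar_space K).
        (\<lambda>n. nrm (scalar_space K) (s n \<ominus>\<^bsub>scalar_space K\<^esub> y)) \<longlonglongrightarrow> 0"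
      by (auto simp: minus intro!: bexI[of _ y] tendsto_norm_zero LIM_zero)
  qed
qed

end

text \<open>An isometric copy in another type, for \<open>f\<close> injective on the carrier. It
  places the scalar field in the type over which clauses (a) and (b) quantify.\<close>

definition transport :: "('a \<Rightarrow> 'b) \<Rightarrow> 'a nspace \<Rightarrow> 'b nspace"
  where "transport f V = (let g = inv_into (carrier V) f in
    \<lparr>carrier = f ` carrier V, mult = undefined, one = undefined, zero = f \<zero>\<^bsub>V\<^esub>,
     add = (\<lambda>a b. f (g a \<oplus>\<^bsub>V\<^esub> g b)), smult = (\<lambda>c a. f (c \<odot>\<^bsub>V\<^esub> g a)), nrm = (\<lambda>a. nrm V (g a))\<rparr>)"

lemma (in banach_space) banach_transport:
  assumes f: "inj_on f (carrier V)"
  shows "banach_space K (transport f V)"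
proof -
  let ?W = "transport f V"
  have simps [simp]: "carrier ?W = f ` carrier V" "\<zero>\<^bsub>?W\<^esub> = f \<zero>"
    "x \<in> carrier V \<Longrightarrow> y \<in> carrier V \<Longrightarrow> f x \<oplus>\<^bsub>?W\<^esub> f y = f (x \<oplus> y)"
    "x \<in> carrier V \<Longrightarrow> c \<odot>\<^bsub>?W\<^esub> f x = f (c \<odot>\<^bsub>V\<^esub> x)"
    "x \<in> carrier V \<Longrightarrow> nrm ?W (f x) = nrm V x" for x y c
    using f by (simp_all add: transport_def Let_def)
  have "normed_space K ?W"
  proof (intro normed_space.intro moduleI)
    show "cring (scalar_ring K)"
      by (rule R.is_cring)
    show "abelian_group ?W"
    proof (rule abelian_groupI)
      fix a assume "a \<in> carrier ?W"
      then obtain x where "x \<in> carrier V" "a = f x"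
        by auto
      then show "\<exists>b\<in>carrier ?W. b \<oplus>\<^bsub>?W\<^esub> a = \<zero>\<^bsub>?W\<^esub>"
        by (intro bexI[of _ "f (\<ominus> x)"]) (auto simp: M.l_neg)
    qed (auto simp: M.a_ac)
    show "normed_space_axioms K ?W"
      by unfold_locales
        (auto simp: scalar_field nrm_nonneg nrm_triangle nrm_smult nrm_eq_zero_iff inj_on_eq_iff[OF f])
  qed (auto simp: scale_add_left scale_add_right scale_scale)
  then interpret W: normed_space K ?W .
  have minus: "f x \<ominus>\<^bsub>?W\<^esub> f y = f (x \<ominus> y)" if "x \<in> carrier V" "y \<in> carrier V" for x y
    using that by (simp add: a_minus_def W.uminus_scale uminus_scale)
  show ?thesis
  proof (rule W.banach_spaceI)
    fix t assume t: "W.MCauchy t"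
    have "\<exists>x. x \<in> carrier V \<and> t n = f x" for n
      using W.MCauchy_closed[OF t, of n] by auto
    then obtain s where s: "\<And>n. s n \<in> carrier V" "\<And>n. t n = f (s n)"
      by metis
    have "MCauchy s"
      by (rule W.MCauchy_of_bound[OF t, of _ V 1]) (auto simp: s minus normed_space_axioms)
    then obtain y where "limitin mtopology s y sequentially"
      using complete unfolding mcomplete_def by blast
    then have "y \<in> carrier V" "(\<lambda>n. nrm V (s n \<ominus> y)) \<longlonglongrightarrow> 0"
      using s by (auto simp: limitin_metric_dist_null ndist_def)
    then show "\<exists>b\<in>carrier ?W. (\<lambda>n. nrm ?W (t n \<ominus>\<^bsub>?W\<^esub> b)) \<longlonglongrightarrow> 0"
      by (intro bexI[of _ "f y"]) (auto simp: s minus)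
  qed
qed


section \<open>Associated operators and the dual ideal\<close>

context tensor_product
begin

text \<open>\<open>U\<close> maps the embedded tensor \<open>u\<close> to the multiple of
  \<open>y\<close> by \<open>u A\<close>. Since the embedding is isometric, a bound \<open>D\<close>
  of \<open>U\<close> gives \<open>cmod (u A) * nrm Y y \<le> D * N u\<close>.\<close>

lemma all_bounded_of_lift:
  assumes Y: "normed_space K Y" and y: "y \<in> carrier Y" "y \<noteq> \<zero>\<^bsub>Y\<^esub>"
    and lift: "\<And>S. S \<in> ops K Z (op_space K X Y) \<Longrightarrow>
      \<exists>U \<in> ops K (completion (tensor_space K Z X N)) Y. \<forall>z\<in>carrier Z. \<forall>x\<in>carrier X.
        U (completion_emb (tensor_space K Z X N) (elem_tensor K Z X z x)) = S z x"
    and A: "bilinear_op K Z X (scalar_space K) A" and "0 \<le> C"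
    and A_le: "\<And>z x. z \<in> carrier Z \<Longrightarrow> x \<in> carrier X \<Longrightarrow> cmod (A z x) \<le> C * (nrm Z z * nrm X x)"
  shows "\<exists>D. \<forall>u\<in>tensors K Z X. cmod (u A) \<le> D * N u"
proof -
  interpret Y: normed_space K Y by fact
  let ?emb = "completion_emb (tensor_space K Z X N)"
  let ?S = "\<lambda>z x. A z x \<odot>\<^bsub>Y\<^esub> y"
  have form: "A \<in> bilinear_forms K Z X"
    using A by (simp add: bilinear_forms_eq)
  note lin1 = linear_opD[OF bilinear_forms_linear(1)[OF form], simplified]
  note lin2 = linear_opD[OF bilinear_forms_linear(2)[OF form], simplified]
  have "bilinear_op K Z X Y ?S"
    using y by (auto simp: bilinear_op_def linear_op_def lin1 lin2 Y.scale_add_left Y.scale_scale)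
  moreover have "nrm Y (?S z x) \<le> (C * nrm Y y) * (nrm Z z * nrm X x)"
    if "z \<in> carrier Z" "x \<in> carrier X" for z x
    using mult_right_mono[OF A_le[OF that] Y.nrm_nonneg[OF y(1)]] that y(1) lin1(1)
    by (simp add: Y.nrm_smult mult_ac)
  ultimately have "(\<lambda>z\<in>carrier Z. \<lambda>x\<in>carrier X. ?S z x) \<in> ops K Z (op_space K X Y)"
    using \<open>0 \<le> C\<close> Y.nrm_nonneg[OF y(1)]
    by (intro ops_of_bilinear_op[where C = "C * nrm Y y"] Z.normed_space_axioms X.normed_space_axioms) auto
  from lift[OF this] obtain U where U: "U \<in> ops K (completion (tensor_space K Z X N)) Y"
    and US: "\<And>z x. z \<in> carrier Z \<Longrightarrow> x \<in> carrier X \<Longrightarrow> U (?emb (elem_tensor K Z X z x)) = ?S z x"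
    by auto
  then obtain D where U_lin: "linear_op K (completion (tensor_space K Z X N)) Y U"
    and D: "\<And>P. P \<in> carrier (completion (tensor_space K Z X N)) \<Longrightarrow>
      nrm Y (U P) \<le> D * nrm (completion (tensor_space K Z X N)) P"
    by (auto simp: mem_ops)
  note embD = linear_opD[OF T.completion_emb_linear, simplified]
  note UD = linear_opD[OF U_lin]
  have U_sum: "U (?emb (tensor_sum K Z X ps)) = tensor_sum K Z X ps A \<odot>\<^bsub>Y\<^esub> y"
    if "set ps \<subseteq> carrier Z \<times> carrier X" for ps
    using that
  proof (induction ps)
    case Nil
    have 0: "(\<lambda>B. 0) \<in> tensors K Z X"
      using T.M.zero_closed by simp
    from embD(3)[OF _ 0, of 0] UD(3)[OF _ embD(1)[OF 0], of 0] UD(1)[OF embD(1)[OF 0]]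
    show ?case
      using y by simp
  next
    case (Cons p ps)
    obtain z x where "p = (z, x)" by fastforce
    with Cons have p: "p = (z, x)" "z \<in> carrier Z" "x \<in> carrier X"
      and IH: "U (?emb (tensor_sum K Z X ps)) = tensor_sum K Z X ps A \<odot>\<^bsub>Y\<^esub> y"
      and ps: "tensor_sum K Z X ps \<in> tensors K Z X"
      by auto
    have "tensor_sum K Z X ps A \<in> K"
      using Cons.prems lin1(1) by (induction ps) (auto simp: tensor_sum_apply[OF form])
    moreover have "elem_tensor K Z X z x \<in> tensors K Z X"
      using p by (simp add: elem_tensor_in_tensors)
    ultimately show ?case
      using p ps y(1) form lin1(1)
      by (simp add: tensor_sum_Cons embD UD US IH Y.scale_add_left) (simp add: elem_tensor_def Y.scale_add_left)
  qed
  have "cmod (u A) \<le> D / nrm Y y * N u" if u: "u \<in> tensors K Z X" for u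
  proof -
    have pos: "0 < nrm Y y"
      using y Y.nrm_nonneg[OF y(1)] Y.nrm_eq_zero_iff[OF y(1)] by linarith
    obtain ps where ps: "set ps \<subseteq> carrier Z \<times> carrier X" "u = tensor_sum K Z X ps"
      using u by (rule tensors_cases)
    have "u A \<in> K"
      using ps lin1(1) unfolding ps(2) tensor_sum_apply[OF form] by (induction ps arbitrary: u) auto
    then have "cmod (u A) * nrm Y y = nrm Y (U (?emb u))"
      using U_sum[OF ps(1)] ps(2) y(1) by (simp add: Y.nrm_smult)
    also have "\<dots> \<le> D * N u"
      using D[OF embD(1)[OF u]] T.completion_emb_nrm[of u] u by simp
    finally show ?thesis
      using pos by (simp add: field_simps)
  qed
  then show ?thesis by blast
qed

lemma lift_of_equivalent:
  assumes Y: "banach_space K Y" and S: "S \<in> ops K Z (op_space K X Y)"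
    and C: "\<And>u. u \<in> tensors K Z X \<Longrightarrow> \<pi> u \<le> C * N u"
  shows "\<exists>U \<in> ops K (completion (tensor_space K Z X N)) Y. \<forall>z\<in>carrier Z. \<forall>x\<in>carrier X.
    U (completion_emb (tensor_space K Z X N) (elem_tensor K Z X z x)) = S z x"
proof -
  interpret Y: banach_space K Y by fact
  note spaces = Z.normed_space_axioms X.normed_space_axioms Y.normed_space_axioms
  obtain D where "0 < D"
    and D: "\<And>z x. z \<in> carrier Z \<Longrightarrow> x \<in> carrier X \<Longrightarrow> nrm Y (S z x) \<le> D * (nrm Z z * nrm X x)"
    using bilinear_op_of_ops(2)[OF spaces S] by blast
  obtain T where T: "linear_op K (tensor_space K Z X N) Y T"
    and TS: "\<And>z x. z \<in> carrier Z \<Longrightarrow> x \<in> carrier X \<Longrightarrow> T (elem_tensor K Z X z x) = S z x"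
    and T_le: "\<And>u. u \<in> tensors K Z X \<Longrightarrow> nrm Y (T u) \<le> D * \<pi> u"
    using tensor_lift[OF Y.normed_space_axioms bilinear_op_of_ops(1)[OF spaces S] \<open>0 < D\<close> D] by blast
  have "nrm Y (T u) \<le> (D * C) * nrm (tensor_space K Z X N) u"
    if "u \<in> carrier (tensor_space K Z X N)" for u
    using order_trans[OF T_le mult_left_mono[OF C]] \<open>0 < D\<close> that by (simp add: mult.assoc)
  from T.extend_to_completion[OF Y T this] obtain U
    where "U \<in> ops K (completion (tensor_space K Z X N)) Y"
    and "\<And>u. u \<in> tensors K Z X \<Longrightarrow> U (completion_emb (tensor_space K Z X N) u) = T u"
    by auto
  with TS show ?thesis
    by (intro bexI[of _ U]) (simp_all add: elem_tensor_in_tensors)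
qed

end

text \<open>Equality of functions reduces to equality on the carriers because \<open>S\<close> and
  all its values there are extensional.\<close>

lemma all_ops_associated_iff:
  "all_ops_associated K \<alpha> Z X Y \<longleftrightarrow> (\<forall>S \<in> ops K Z (op_space K X Y).
    \<exists>U \<in> ops K (completion (tensor_space K Z X (\<alpha> Z X))) Y. \<forall>z\<in>carrier Z. \<forall>x\<in>carrier X.
      U (completion_emb (tensor_space K Z X (\<alpha> Z X)) (elem_tensor K Z X z x)) = S z x)"
proof -
  have "associated_op K \<alpha> Z X U = S \<longleftrightarrow> (\<forall>z\<in>carrier Z. \<forall>x\<in>carrier X.
      U (completion_emb (tensor_space K Z X (\<alpha> Z X)) (elem_tensor K Z X z x)) = S z x)"
    if S: "S \<in> ops K Z (op_space K X Y)" for S U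
  proof
    assume eq: "\<forall>z\<in>carrier Z. \<forall>x\<in>carrier X.
      U (completion_emb (tensor_space K Z X (\<alpha> Z X)) (elem_tensor K Z X z x)) = S z x"
    have ext: "S \<in> extensional (carrier Z)"
      using S by (simp add: mem_ops)
    have "S z \<in> extensional (carrier X)" if "z \<in> carrier Z" for z
    proof -
      have "S z \<in> ops K X Y"
        using S that by (auto simp: mem_ops[of S] dest: linear_opD(1))
      then show ?thesis
        by (simp add: mem_ops)
    qed
    with ext eq show "associated_op K \<alpha> Z X U = S"
      unfolding associated_op_def
      by (intro extensionalityI[of _ "carrier Z"] extensionalityI[of _ "carrier X"]) auto
  qed (auto simp: associated_op_def)
  then show ?thesis
    by (auto simp: all_ops_associated_def completed_tensor_def)
qed

text \<open>\<open>A\<close> is itself a bilinear form, so the sum over a list is the value at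
  \<open>A\<close> of the tensor it represents, and bounds over lists become bounds over
  tensors.\<close>

lemma dual_ideal_iff:
  assumes "normed_space K Z" "normed_space K X" and A: "A \<in> ops K Z (dual_space K X)"
  shows "A \<in> dual_ideal K \<alpha> Z X \<longleftrightarrow> (\<exists>C. \<forall>u\<in>tensors K Z X. cmod (u A) \<le> C * \<alpha> Z X u)"
proof -
  interpret X: normed_space K X by fact
  have "A \<in> bilinear_forms K Z X"
    using bilinear_op_of_ops(1)[OF assms(1,2) X.normed_scalar_space] A
    by (simp add: dual_space_def bilinear_forms_eq)
  then show ?thesis
    using A by (simp add: dual_ideal_def tensors_def tensor_sum_apply[symmetric]) blast
qed

text \<open>The implications form a cycle from \<open>a\<close> to \<open>d\<close> and back. The
  injection into \<open>'y\<close> ensures that this type is large enough to carry a nonzero Banach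
  space; over a one-element type \<open>a\<close> would hold and \<open>b\<close> fail.\<close>

theorem theorem2p1:
  fixes K :: "complex set"
    and X Z :: "'u nspace"
    and \<alpha> :: "'u tensor_norm"
  assumes "banach_space K X" and "banach_space K Z"
    and "tensor_norm K \<alpha>"
    and "\<exists>f :: complex \<Rightarrow> 'y. inj f"
  defines "a \<equiv> \<forall>Y :: 'y nspace. banach_space K Y \<longrightarrow> all_ops_associated K \<alpha> Z X Y"
    and "b \<equiv> \<exists>Y :: 'y nspace. banach_space K Y \<and> carrier Y \<noteq> {\<zero>\<^bsub>Y\<^esub>} \<and> all_ops_associated K \<alpha> Z X Y"
    and "c \<equiv> ops K Z (dual_space K X) = dual_ideal K \<alpha> Z X"
    and "d \<equiv> norms_equivalent_on (tensors K Z X) (\<alpha> Z X) (projective_norm K Z X)"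
  shows "(a \<longleftrightarrow> b) \<and> (b \<longleftrightarrow> c) \<and> (c \<longleftrightarrow> d)"
proof -
  interpret X: banach_space K X by fact
  interpret Z: banach_space K Z by fact
  interpret tensor_norm K \<alpha> by fact
  interpret tensor_product K Z X "\<alpha> Z X"
    by (intro tensor_product.intro tensor_product_axioms.intro norm le_projective assms(1,2)
        Z.normed_space_axioms X.normed_space_axioms)
  note spaces = Z.normed_space_axioms X.normed_space_axioms
  note scalars = X.normed_scalar_space
  have "a \<Longrightarrow> b"
  proof -
    assume a
    obtain f :: "complex \<Rightarrow> 'y" where f: "inj f"
      using assms(4) by blast
    interpret S: banach_space K "scalar_space K"
      by (rule X.banach_scalar_space)
    let ?Y = "transport f (scalar_space K)"
    have "banach_space K ?Y"
      using f by (intro S.banach_transport) (auto intro: inj_on_subset)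
    moreover have "f 1 \<in> carrier ?Y" "f 1 \<noteq> \<zero>\<^bsub>?Y\<^esub>"
      using f by (auto simp: transport_def Let_def dest: injD)
    ultimately show b
      using \<open>a\<close> unfolding a_def b_def by blast
  qed
  moreover have "b \<Longrightarrow> c"
  proof -
    assume b
    then obtain Y :: "'y nspace" where Y: "banach_space K Y" "carrier Y \<noteq> {\<zero>\<^bsub>Y\<^esub>}"
      and lift: "all_ops_associated K \<alpha> Z X Y"
      unfolding b_def by blast
    interpret Y: banach_space K Y by fact
    obtain y where y: "y \<in> carrier Y" "y \<noteq> \<zero>\<^bsub>Y\<^esub>"
      using Y(2) Y.M.zero_closed by blast
    have "A \<in> dual_ideal K \<alpha> Z X" if A: "A \<in> ops K Z (dual_space K X)" for A
    proof -
      note bil = bilinear_op_of_ops[OF spaces scalars A[unfolded dual_space_def]]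
      obtain C where "0 < C" "\<And>z x. z \<in> carrier Z \<Longrightarrow> x \<in> carrier X \<Longrightarrow>
          cmod (A z x) \<le> C * (nrm Z z * nrm X x)"
        using bil(2) by auto
      then have "\<exists>D. \<forall>u\<in>tensors K Z X. cmod (u A) \<le> D * \<alpha> Z X u"
        using lift unfolding all_ops_associated_iff
        by (intro all_bounded_of_lift[OF Y.normed_space_axioms y _ bil(1), of C]) auto
      then show ?thesis
        by (simp add: dual_ideal_iff[OF spaces A])
    qed
    then show c
      unfolding c_def by (auto simp: dual_ideal_def)
  qed
  moreover have "c \<Longrightarrow> d"
  proof -
    assume c
    have "\<exists>C. \<forall>u\<in>tensors K Z X. cmod (u F) \<le> C * \<alpha> Z X u"
      if F: "F \<in> bilinear_forms K Z X"
        and bound: "\<exists>C. \<forall>z\<in>carrier Z. \<forall>x\<in>carrier X. cmod (F z x) \<le> C * (nrm Z z * nrm X x)" for F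
    proof -
      from bound obtain C where C: "\<And>z x. z \<in> carrier Z \<Longrightarrow> x \<in> carrier X \<Longrightarrow>
          cmod (F z x) \<le> C * (nrm Z z * nrm X x)"
        by blast
      \<comment> \<open>\<open>F\<close> is arbitrary off the carriers, whereas \<open>c\<close>
        speaks of extensional operators.\<close>
      let ?A = "\<lambda>z\<in>carrier Z. \<lambda>x\<in>carrier X. F z x"
      have "cmod (F z x) \<le> \<bar>C\<bar> * (nrm Z z * nrm X x)" if "z \<in> carrier Z" "x \<in> carrier X" for z x
        using C[OF that] mult_right_mono[OF abs_ge_self[of C], of "nrm Z z * nrm X x"]
          Z.nrm_nonneg[OF that(1)] X.nrm_nonneg[OF that(2)] by simp
      then have A: "?A \<in> ops K Z (dual_space K X)"
        unfolding dual_space_def using F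
        by (intro ops_of_bilinear_op[OF spaces, where C = "\<bar>C\<bar>"]) (auto simp: bilinear_forms_eq)
      then have "?A \<in> dual_ideal K \<alpha> Z X"
        using \<open>c\<close> by (simp add: c_def)
      then obtain D where D: "\<And>u. u \<in> tensors K Z X \<Longrightarrow> cmod (u ?A) \<le> D * \<alpha> Z X u"
        using dual_ideal_iff[OF spaces A] by blast
      have form: "?A \<in> bilinear_forms K Z X"
        using bilinear_op_of_ops(1)[OF spaces scalars] A by (simp add: dual_space_def bilinear_forms_eq)
      have "u ?A = u F" if "u \<in> tensors K Z X" for u
        using tensor_form_linear[OF that F F form, of 0] by simp
      with D show ?thesis by (metis (lifting))
    qed
    from projective_le_of_bounded_forms[OF this] obtain C
      where C: "0 < C" "\<And>u. u \<in> tensors K Z X \<Longrightarrow> \<pi> u \<le> C * \<alpha> Z X u"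
      by blast
    \<comment> \<open>The lower constant is 1 because \<open>\<alpha>\<close> lies below
      \<open>\<pi>\<close>.\<close>
    show d
      unfolding d_def norms_equivalent_on_def
      using N_le C by (intro exI[of _ "1 :: real"] conjI exI[of _ C] ballI) simp_all
  qed
  \<comment> \<open>The inequality bounding \<open>\<pi>\<close> by a multiple of
    \<open>\<alpha>\<close> turns the lift, bounded for \<open>\<pi>\<close>, into one that
    extends.\<close>
  moreover have "d \<Longrightarrow> a"
    unfolding a_def all_ops_associated_iff d_def norms_equivalent_on_def
    using lift_of_equivalent by blast
  ultimately show ?thesis by blast
qed

end
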